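(* Let $(\mathcal X,\mathsf d)$ be a metric local structure. For every $\tau_{\mathrm v}$-Borel set $\Xi\subset\Upsilon$, the function $\gamma\mapsto\mathsf d_\Upsilon(\gamma,\Xi)=\inf_{\eta\in\Xi}\mathsf d_\Upsilon(\gamma,\eta)$ is $\Sigma_{\mathrm v}^*$-measurable, where $\Sigma_{\mathrm v}^*$ is the $\sigma$-algebra of universally measurable subsets of $(\Upsilon,\tau_{\mathrm v})$.
   Context: A metric local structure $(\mathcal X,\mathsf d)$, $\mathcal X=(X,\tau,\Sigma,\mathsf m,\mathscr E_{\mathsf d})$, consists of a non-empty complete separable metric space $(X,\mathsf d)$ with topology $\tau$, a $\sigma$-algebra $\Sigma$ with $\mathscr B_\tau\subset\Sigma\subset\mathscr B_\tau^{\mathsf m}$ (Borel $\sigma$-algebra and its $\mathsf m$-completion), and a $\sigma$-finite atomless Radon measure $\mathsf m$ on $\Sigma$ with full support, finite on every set of the ring $\mathscr E_{\mathsf d}$ of all $\mathsf d$-bounded sets in $\Sigma$. $\Upsilon$ is the set of all $\gamma=\sum_{i\le N}\delta_{x_i}$, $N\in\mathbb N_0\cup\{\infty\}$, $x_i\in X$ (repetitions allowed), with $\gamma E<\infty$ for all $E\in\mathscr E_{\mathsf d}$; $\Sigma_{\mathrm v}$ is the $\sigma$-algebra generated by $\gamma\mapsto\gamma E$, $E\in\mathscr E_{\mathsf d}$; $\tau_{\mathrm v}$ is the topology generated by $\gamma\mapsto\int f\,d\gamma$, $f$ bounded continuous vanishing outside a bounded set. $\mathsf d_\Upsilon(\gamma,\eta)=\inf_q\big(\int_{X\times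 X}\mathsf d^2(x,y)\,dq(x,y)\big)^{1/2}\in[0,\infty]$, the infimum over measures $q$ on $X\times X$ with marginals $\gamma,\eta$ ($\inf\emptyset=+\infty$). *)

theory Defs
  imports "HOL-Probability.Probability"
begin

section \<open>Metric local structures\<close>

definition bounded_ring :: "'a::metric_space measure \<Rightarrow> 'a set set" where
  "bounded_ring m = {E \<in> sets m. bounded E}"

definition atomless :: "'a measure \<Rightarrow> bool" where
  "atomless m \<longleftrightarrow>
    \<not> (\<exists>A\<in>sets m. emeasure m A > 0 \<and>
         (\<forall>B\<in>sets m. B \<subseteq> A \<longrightarrow> emeasure m B = 0 \<or> emeasure m (A - B) = 0))"

definition radon :: "'a::topological_space measure \<Rightarrow> bool" where
  "radon m \<longleftrightarrow>
    (\<forall>x. \<exists>U. open U \<and> x \<in> U \<and> emeasure m U < \<infinity>) \<and>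
    (\<forall>A\<in>sets m. emeasure m A = (SUP K\<in>{K. compact K \<and> K \<subseteq> A}. emeasure m K))"

definition full_support :: "'a::topological_space measure \<Rightarrow> bool" where
  "full_support m \<longleftrightarrow> (\<forall>U. open U \<longrightarrow> U \<noteq> {} \<longrightarrow> emeasure m U > 0)"

text \<open>The complete separable metric space is the whole type, with metric \<open>dist\<close>; the
  \<open>\<sigma>\<close>-algebra \<open>\<Sigma>\<close> is \<open>sets m\<close>.  The upper bound on \<open>\<Sigma>\<close> is the completion of the Borel
  \<open>\<sigma>\<close>-algebra with respect to the restriction of \<open>m\<close> to it.\<close>

locale metric_local_structure = sigma_finite_measure m
  for m :: "'a::polish_space measure" +
  assumes space_UNIV: "space m = UNIV"
    and borel_subset_sets: "sets borel \<subseteq> sets m"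
    and sets_subset_completion: "sets m \<subseteq> sets (completion (restr_to_subalg m borel))"
    and atomless: "atomless m"
    and radon: "radon m"
    and full_support: "full_support m"
    and finite_on_bounded: "\<And>E. E \<in> bounded_ring m \<Longrightarrow> emeasure m E < \<infinity>"

section \<open>Configuration spaces\<close>

text \<open>\<open>return m x\<close> is the Dirac measure at \<open>x\<close> on the \<open>\<sigma>\<close>-algebra \<open>sets m\<close>.\<close>

definition configurations :: "'a::metric_space measure \<Rightarrow> 'a measure set" where
  "configurations m =
    {\<gamma>. sets \<gamma> = sets m \<and>
        (\<exists>(N::enat) (x :: nat \<Rightarrow> 'a). \<forall>A\<in>sets m.
           emeasure \<gamma> A = (\<Sum>i. if enat i < N then emeasure (return m (x i)) A else 0)) \<and>
        (\<forall>E\<in>bounded_ring m. emeasure \<gamma> E < \<infinity>)}"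

definition bounded_support_continuous :: "('a::metric_space \<Rightarrow> real) set" where
  "bounded_support_continuous =
    {f. continuous_on UNIV f \<and> bounded (range f) \<and> (\<exists>B. bounded B \<and> (\<forall>x. x \<notin> B \<longrightarrow> f x = 0))}"

definition vague_topology :: "'a::metric_space measure \<Rightarrow> 'a measure topology" where
  "vague_topology m = topology_generated_by
    {{\<gamma> \<in> configurations m. integral\<^sup>L \<gamma> f \<in> U} | f U. f \<in> bounded_support_continuous \<and> open U}"

lemma topspace_vague_topology: "topspace (vague_topology m) = configurations m"
proof -
  have z: "(\<lambda>_. 0) \<in> bounded_support_continuous"
    by (auto simp: bounded_support_continuous_def intro!: exI[of _ "{}"])
  have "configurations m = {\<gamma> \<in> configurations m. (LINT x|\<gamma>. (0::real)) \<in> UNIV}"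
    by simp
  then have "configurations m \<in> {{\<gamma> \<in> configurations m. integral\<^sup>L \<gamma> f \<in> U} | f U.
      f \<in> bounded_support_continuous \<and> open U}"
    using z open_UNIV by blast
  then show ?thesis
    unfolding vague_topology_def topology_generated_by_topspace by blast
qed

section \<open>Borel and universally measurable sets of a topology\<close>

definition borel_algebra :: "'b topology \<Rightarrow> 'b measure" where
  "borel_algebra T = sigma (topspace T) {U. openin T U}"

definition universally_measurable :: "'b topology \<Rightarrow> 'b set \<Rightarrow> bool" where
  "universally_measurable T A \<longleftrightarrow> A \<subseteq> topspace T \<and>
    (\<forall>\<mu>. finite_measure \<mu> \<longrightarrow> sets \<mu> = sets (borel_algebra T) \<longrightarrow> A \<in> sets (completion \<mu>))"

definition universal_algebra :: "'b topology \<Rightarrow> 'b measure" where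
  "universal_algebra T = sigma (topspace T) {A. universally_measurable T A}"

lemma space_borel_algebra: "space (borel_algebra T) = topspace T"
  by (auto simp: borel_algebra_def space_measure_of_conv)

lemma space_universal_algebra: "space (universal_algebra T) = topspace T"
  by (auto simp: universal_algebra_def space_measure_of_conv)

text \<open>The universally measurable sets already form a \<open>\<sigma>\<close>-algebra.\<close>

lemma sets_universal_algebra:
  fixes T :: "'b topology"
  shows "sets (universal_algebra T) = {A. universally_measurable T A}"
proof -
  have sp: "space \<mu> = topspace T" if "sets \<mu> = sets (borel_algebra T)" for \<mu>
    using sets_eq_imp_space_eq[OF that] by (simp add: space_borel_algebra)
  have "sigma_algebra (topspace T) {A. universally_measurable T A}"
    unfolding sigma_algebra_iff2
  proof (intro conjI ballI allI impI)
    show "{A. universally_measurable T A} \<subseteq> Pow (topspace T)"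
      by (auto simp: universally_measurable_def)
    show "{} \<in> {A. universally_measurable T A}"
      by (simp add: universally_measurable_def)
    show "topspace T - A \<in> {A. universally_measurable T A}"
      if A: "A \<in> {A. universally_measurable T A}" for A
      unfolding universally_measurable_def mem_Collect_eq
    proof (intro conjI allI impI)
      show "topspace T - A \<in> sets (completion \<mu>)"
        if \<mu>: "finite_measure \<mu>" "sets \<mu> = sets (borel_algebra T)" for \<mu>
      proof -
        have "A \<in> sets (completion \<mu>)"
          using A \<mu> by (simp add: universally_measurable_def)
        from sets.compl_sets[OF this] show ?thesis
          by (simp only: space_completion sp[OF \<mu>(2)])
      qed
    qed blast
    show "(\<Union>i. A i) \<in> {A. universally_measurable T A}"
      if A: "range A \<subseteq> {A. universally_measurable T A}" for A :: "nat \<Rightarrow> 'b set"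
      unfolding universally_measurable_def mem_Collect_eq
    proof (intro conjI allI impI)
      show "(\<Union>i. A i) \<subseteq> topspace T"
        using A by (auto simp: universally_measurable_def)
      show "(\<Union>i. A i) \<in> sets (completion \<mu>)"
        if \<mu>: "finite_measure \<mu>" "sets \<mu> = sets (borel_algebra T)" for \<mu>
      proof (rule sets.countable_UN, rule subsetI)
        fix B assume "B \<in> range A"
        with A have "universally_measurable T B" by blast
        with \<mu> show "B \<in> sets (completion \<mu>)" by (simp add: universally_measurable_def)
      qed
    qed
  qed
  then show ?thesis
    unfolding universal_algebra_def
    by (simp add: sigma_algebra.sets_measure_of_eq)
qed

section \<open>The transport distance on configurations\<close>

definition ennreal_sqrt :: "ennreal \<Rightarrow> ennreal" where
  "ennreal_sqrt t = (if t = \<infinity> then \<infinity> else ennreal (sqrt (enn2real t)))"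

definition couplings :: "'a measure \<Rightarrow> 'a measure \<Rightarrow> 'a measure \<Rightarrow> ('a \<times> 'a) measure set" where
  "couplings m \<gamma> \<eta> =
    {q. sets q = sets (m \<Otimes>\<^sub>M m) \<and> distr q m fst = \<gamma> \<and> distr q m snd = \<eta>}"

definition d_conf :: "'a::metric_space measure \<Rightarrow> 'a measure \<Rightarrow> 'a measure \<Rightarrow> ennreal" where
  "d_conf m \<gamma> \<eta> =
    (INF q\<in>couplings m \<gamma> \<eta>. ennreal_sqrt (\<integral>\<^sup>+ (x, y). ennreal ((dist x y)\<^sup>2) \<partial>q))"

definition d_conf_set :: "'a::metric_space measure \<Rightarrow> 'a measure \<Rightarrow> 'a measure set \<Rightarrow> ennreal" where
  "d_conf_set m \<gamma> \<Xi> = (INF \<eta>\<in>\<Xi>. d_conf m \<gamma> \<eta>)"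

end

theory Submission
  imports Defs
begin

text \<open>
  It suffices that each sublevel set \<open>{\<gamma>. d_conf_set m \<gamma> \<Xi> < r}\<close> is universally measurable.
  Such a set is a projection: \<open>\<gamma>\<close> belongs to it iff there are \<open>\<eta> \<in> \<Xi>\<close> and a coupling of \<open>\<gamma>\<close>
  and \<open>\<eta>\<close> of small cost.  Projections of Borel sets need not be Borel, but they are analytic,
  and analytic subsets of a Hausdorff space are universally measurable.

  The second half of this is general topology.  A closed subset of \<open>\<real>\<^sup>\<nat>\<close> is exhausted by its
  intersections with compact boxes, up to arbitrarily small loss of outer measure of the image
  under a continuous map, and images of compact sets are closed; hence
  \<open>analytic_in_universally_measurable\<close>.  Borel subsets of a Polish space are analytic
  (\<open>analytic_in_borel\<close>), because the analytic sets with analytic complement form a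
  \<open>\<sigma>\<close>-algebra containing the open sets.

  It remains to write the sublevel set as a countable union of continuous images of Borel sets
  in Polish spaces.  For fixed numbers of points \<open>N\<close> and \<open>M\<close> the data \<open>(\<gamma>, \<eta>, q)\<close> are
  described by two sequences of points and a matrix.  The sequences carry a witness of local
  finiteness, which makes the passage to configurations continuous for the vague topology
  (\<open>continuous_map_configuration_of\<close>).  A coupling of \<open>\<Sum>\<^sub>i \<delta>(x i)\<close> and \<open>\<Sum>\<^sub>j \<delta>(y j)\<close> has a
  density with respect to the product of its marginals, so couplings may be replaced by
  matrices with unit row and column sums (\<open>d_conf_less_iff\<close>), and these conditions as well as
  the bound on the cost are plainly Borel in the points and the entries.
\<close>

section \<open>Analytic sets\<close>

text \<open>A subset of a topological space is analytic if it is a continuous image of a closed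
  subset of \<open>\<real>\<^sup>\<nat>\<close>.  This is the usual notion: closed subsets of \<open>\<real>\<^sup>\<nat>\<close> are Polish, and
  every Polish space is such an image.\<close>

definition analytic_in :: "'b topology \<Rightarrow> 'b set \<Rightarrow> bool" where
  "analytic_in T A \<longleftrightarrow> (\<exists>(C :: (nat \<Rightarrow> real) set) \<phi>.
     closed C \<and> continuous_map (top_of_set C) T \<phi> \<and> \<phi> ` C = A)"

lemma tendsto_fun_iff:
  fixes l :: "'i \<Rightarrow> 'b::topological_space"
  shows "(f \<longlongrightarrow> l) F \<longleftrightarrow> (\<forall>i. ((\<lambda>k. f k i) \<longlongrightarrow> l i) F)"
  using limitin_componentwise[of "\<lambda>i. euclidean" UNIV f l F]
  by (simp add: euclidean_product_topology)

lemma tendsto_coordinate: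
  fixes l :: "'i \<Rightarrow> 'b::topological_space"
  shows "(f \<longlongrightarrow> l) F \<Longrightarrow> ((\<lambda>k. f k i) \<longlongrightarrow> l i) F"
  by (simp add: tendsto_fun_iff)

lemma Nats_eq_if_dist_less_one:
  fixes a b :: real
  assumes "a \<in> \<nat>" "b \<in> \<nat>" "dist a b < 1"
  shows "a = b"
proof -
  obtain i j where "a = real i" "b = real j"
    using assms(1,2) by (auto elim!: Nats_cases)
  then show ?thesis
    using assms(3) by (simp add: dist_real_def)
qed

lemma dist_le_geometric_if_step_le:
  fixes u :: "nat \<Rightarrow> 'p::metric_space"
  assumes "\<And>n. dist (u n) (u (Suc n)) \<le> (1/2)^n"
  shows "dist (u n) (u (n + m)) \<le> 2 * (1/2)^n - 2 * (1/2)^(n + m)"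
proof (induction m)
  case (Suc m)
  have "dist (u n) (u (n + Suc m)) \<le> dist (u n) (u (n + m)) + dist (u (n + m)) (u (n + Suc m))"
    by (rule dist_triangle)
  then show ?case
    using Suc assms[of "n + m"] by simp
qed simp

lemma geometric_steps_converge:
  fixes u :: "nat \<Rightarrow> 'p::complete_space"
  assumes "\<And>n. dist (u n) (u (Suc n)) \<le> (1/2)^n"
  shows "u \<longlonglongrightarrow> lim u" and "dist (u n) (lim u) \<le> 2 * (1/2)^n"
proof -
  have le: "dist (u n) (u (n + m)) \<le> 2 * (1/2)^n" for n m
    using dist_le_geometric_if_step_le[of u n m, OF assms]
      zero_le_power[of "1/2::real" "n + m"] by linarith
  have "Cauchy u"
  proof (rule CauchyI')
    fix e :: real assume "e > 0"
    then obtain M where "(1/2)^M < e/2"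
      using real_arch_pow_inv[of "e/2" "1/2"] by auto
    moreover have "dist (u m) (u n) \<le> 2 * (1/2)^M" if "M \<le> m" "m < n" for m n
    proof -
      have "dist (u m) (u (m + (n - m))) \<le> 2 * (1/2)^m" by (rule le)
      also have "2 * (1/2::real)^m \<le> 2 * (1/2)^M"
        using that by (simp add: power_decreasing)
      finally show ?thesis using that by simp
    qed
    ultimately show "\<exists>M. \<forall>m\<ge>M. \<forall>n>m. dist (u m) (u n) < e"
      by (intro exI[of _ M]) force
  qed
  then show lim: "u \<longlonglongrightarrow> lim u"
    using Cauchy_convergent convergent_LIMSEQ_iff by blast
  have "(\<lambda>m. dist (u n) (u (m + n))) \<longlonglongrightarrow> dist (u n) (lim u)"
    by (intro tendsto_intros LIMSEQ_ignore_initial_segment lim)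
  then show "dist (u n) (lim u) \<le> 2 * (1/2)^n"
    by (rule LIMSEQ_le_const2) (use le[of n] in \<open>metis add.commute\<close>)
qed

text \<open>A point is the limit of a fast Cauchy sequence in a countable dense set, so it is
  coded by the sequence of indices of that sequence.\<close>

lemma polish_space_eq_image_closed:
  "\<exists>(C :: (nat \<Rightarrow> real) set) (\<phi> :: _ \<Rightarrow> 'p::polish_space).
     closed C \<and> continuous_on C \<phi> \<and> \<phi> ` C = UNIV"
proof -
  obtain D :: "'p set" where D: "countable D"
    "\<And>X. open X \<Longrightarrow> X \<noteq> {} \<Longrightarrow> \<exists>d\<in>D. d \<in> X"
    using countable_dense_setE by blast
  define d where "d = from_nat_into D"
  have dense: "\<exists>i. dist (d i) x < e" if "e > 0" for x e
  proof -
    have "ball x e \<noteq> {}" using that by (metis centre_in_ball empty_iff)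
    then have "\<exists>y\<in>D. y \<in> ball x e" by (intro D(2)) auto
    then obtain y where y: "y \<in> D" "y \<in> ball x e" by blast
    then obtain i where "d i = y"
      unfolding d_def using D(1) by (metis from_nat_into_surj)
    with y show ?thesis by (auto simp: dist_commute)
  qed
  define u where "u s n = d (nat \<lfloor>s n\<rfloor>)" for s :: "nat \<Rightarrow> real" and n
  define C where "C = {s. (\<forall>n. s n \<in> \<nat>) \<and> (\<forall>n. dist (u s n) (u s (Suc n)) \<le> (1/2)^n)}"
  define \<phi> where "\<phi> s = lim (u s)" for s
  have conv: "u s \<longlonglongrightarrow> \<phi> s" "dist (u s n) (\<phi> s) \<le> 2 * (1/2)^n" if "s \<in> C" for s n
    using that geometric_steps_converge[of "u s"] by (auto simp: C_def \<phi>_def)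
  have "closed C"
  proof (unfold closed_sequential_limits, intro allI impI)
    fix f s assume "(\<forall>k. f k \<in> C) \<and> f \<longlonglongrightarrow> s"
    then have f: "\<And>k. f k \<in> C" "f \<longlonglongrightarrow> s" by auto
    have nat: "s n \<in> \<nat>" for n
      by (rule closed_sequentially[of \<nat> "\<lambda>k. f k n"])
        (use f in \<open>auto simp: C_def closed_Nats intro: tendsto_coordinate\<close>)
    have ev: "eventually (\<lambda>k. f k n = s n) sequentially" for n
    proof -
      have "eventually (\<lambda>k. dist (f k n) (s n) < 1) sequentially"
        by (rule tendstoD[OF tendsto_coordinate[OF f(2)]]) simp
      then show ?thesis
        by eventually_elim (use f(1) nat in \<open>auto simp: C_def intro!: Nats_eq_if_dist_less_one\<close>)
    qed
    have "dist (u s n) (u s (Suc n)) \<le> (1/2)^n" for n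
    proof -
      have "eventually (\<lambda>k. f k n = s n \<and> f k (Suc n) = s (Suc n)) sequentially"
        by (intro eventually_conj ev)
      then obtain k where k: "f k n = s n" "f k (Suc n) = s (Suc n)"
        by (auto simp: eventually_sequentially)
      have "dist (u (f k) n) (u (f k) (Suc n)) \<le> (1/2)^n"
        using f(1)[of k] by (simp add: C_def)
      with k show ?thesis by (simp add: u_def)
    qed
    with nat show "s \<in> C" by (simp add: C_def)
  qed
  moreover have "continuous_on C \<phi>"
    unfolding continuous_on_def
  proof (intro ballI tendstoI)
    fix s e assume s: "s \<in> C" and "e > (0::real)"
    then obtain n where n: "(1/2)^n < e/4"
      using real_arch_pow_inv[of "e/4" "1/2"] by auto
    have "eventually (\<lambda>t. dist (t n) (s n) < 1) (at s within C)"
      by (rule tendstoD[OF tendsto_coordinate[OF tendsto_ident_at]]) simp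
    moreover have "eventually (\<lambda>t. t \<in> C) (at s within C)"
      by (simp add: eventually_at_filter)
    ultimately show "eventually (\<lambda>t. dist (\<phi> t) (\<phi> s) < e) (at s within C)"
    proof eventually_elim
      case (elim t)
      then have "t n = s n"
        using s by (auto simp: C_def intro!: Nats_eq_if_dist_less_one)
      then have "u t n = u s n" by (simp add: u_def)
      then have "dist (\<phi> t) (\<phi> s) \<le> 4 * (1/2)^n"
        using conv(2)[OF elim(2), of n] conv(2)[OF s, of n] dist_triangle3[of "\<phi> t" "\<phi> s" "u s n"]
        by simp
      with n show ?case by linarith
    qed
  qed
  moreover have "x \<in> \<phi> ` C" for x
  proof -
    have "\<exists>i. \<forall>n. dist (d (i n)) x < (1/2)^n / 2"
      by (intro choice allI dense) simp
    then obtain i where i: "\<And>n. dist (d (i n)) x < (1/2)^n / 2" by blast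
    define s where "s n = real (i n)" for n
    have us: "u s = (\<lambda>n. d (i n))" by (intro ext) (simp add: u_def s_def)
    have "dist (d (i n)) (d (i (Suc n))) \<le> (1/2)^n" for n
      using i[of n] i[of "Suc n"] dist_triangle2[of "d (i n)" "d (i (Suc n))" x]
        zero_le_power[of "1/2::real" n] unfolding power_Suc by linarith
    then have s: "s \<in> C" by (simp add: C_def us) (simp add: s_def)
    have "(\<lambda>n. (1/2::real)^n / 2) \<longlonglongrightarrow> 0"
      by real_asymp
    then have "(\<lambda>n. dist (d (i n)) x) \<longlonglongrightarrow> 0"
      by (rule tendsto_sandwich[OF _ _ tendsto_const, rotated 2])
        (use i in \<open>auto intro!: always_eventually less_imp_le\<close>)
    then have "u s \<longlonglongrightarrow> x" by (simp add: tendsto_dist_iff[symmetric] us)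
    then have "\<phi> s = x" using conv(1)[OF s] LIMSEQ_unique by blast
    with s show ?thesis by blast
  qed
  ultimately show ?thesis by blast
qed

lemma analytic_in_image_closed:
  fixes D :: "'p::polish_space set"
  assumes "closed D" "continuous_map (top_of_set D) T f"
  shows "analytic_in T (f ` D)"
proof -
  obtain C :: "(nat \<Rightarrow> real) set" and \<phi> :: "_ \<Rightarrow> 'p" where
    C: "closed C" "continuous_on C \<phi>" "\<phi> ` C = UNIV"
    using polish_space_eq_image_closed by blast
  define C' where "C' = C \<inter> \<phi> -` D"
  have "closed C'"
    unfolding C'_def by (rule continuous_closed_preimage) (use C assms in auto)
  moreover have "continuous_map (top_of_set C') (top_of_set D) \<phi>"
    using C(2) by (auto simp: C'_def intro: continuous_on_subset)
  then have "continuous_map (top_of_set C') T (f \<circ> \<phi>)"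
    using assms(2) by (rule continuous_map_compose)
  moreover have "\<phi> ` C' = D" using C(3) by (force simp: C'_def)
  then have "(f \<circ> \<phi>) ` C' = f ` D" by (metis image_comp)
  ultimately show ?thesis unfolding analytic_in_def by blast
qed

lemma analytic_in_image:
  assumes "analytic_in S A" "continuous_map (subtopology S A) T f"
  shows "analytic_in T (f ` A)"
proof -
  obtain C :: "(nat \<Rightarrow> real) set" and \<phi> where
    C: "closed C" "continuous_map (top_of_set C) S \<phi>" "\<phi> ` C = A"
    using assms(1) unfolding analytic_in_def by blast
  then have "continuous_map (top_of_set C) (subtopology S A) \<phi>"
    by (auto simp: continuous_map_in_subtopology)
  then have "continuous_map (top_of_set C) T (f \<circ> \<phi>)"
    using assms(2) by (rule continuous_map_compose)
  moreover have "(f \<circ> \<phi>) ` C = f ` A" using C(3) by (metis image_comp)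
  ultimately show ?thesis using C(1) unfolding analytic_in_def by blast
qed

instance prod :: (polish_space, polish_space) polish_space ..

lemma analytic_in_closed:
  fixes D :: "'p::polish_space set"
  assumes "closed D"
  shows "analytic_in euclidean D"
  using analytic_in_image_closed[OF assms, of euclidean "\<lambda>x. x"] by simp

text \<open>The preimages of the \<open>A n\<close> are made disjoint, and their union closed, by adding the
  coordinate \<open>n\<close>.\<close>

lemma analytic_in_UN:
  fixes A :: "nat \<Rightarrow> 'b::topological_space set"
  assumes "\<And>n. analytic_in euclidean (A n)"
  shows "analytic_in euclidean (\<Union>n. A n)"
proof -
  obtain C :: "nat \<Rightarrow> (nat \<Rightarrow> real) set" and \<phi> where
    C: "\<And>n. closed (C n)" "\<And>n. continuous_on (C n) (\<phi> n)" "\<And>n. \<phi> n ` C n = A n"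
  proof -
    have "\<exists>C \<phi>. closed (C :: (nat \<Rightarrow> real) set) \<and> continuous_on C \<phi> \<and> \<phi> ` C = A n" for n
      using assms[of n] by (auto simp: analytic_in_def)
    then show thesis using that by metis
  qed
  define D where "D = (\<Union>n. {real n} \<times> C n)"
  define f where "f = (\<lambda>(t :: real, s). \<phi> (nat \<lfloor>t\<rfloor>) s)"
  have near: "eventually (\<lambda>z. fst z = fst w) (at w within D)" if "w \<in> D" for w
  proof -
    have "eventually (\<lambda>z. dist (fst z) (fst w) < 1) (at w within D)"
      by (intro tendstoD[OF tendsto_fst] tendsto_ident_at) simp
    moreover have "eventually (\<lambda>z. z \<in> D) (at w within D)"
      by (simp add: eventually_at_filter)
    ultimately show ?thesis
    proof eventually_elim
      case (elim z)
      then have "fst z \<in> \<nat>" "fst w \<in> \<nat>" using elim that by (auto simp: D_def)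
      with elim(1) show ?case using Nats_eq_if_dist_less_one by blast
    qed
  qed
  have "closed D"
  proof (unfold closed_sequential_limits, intro allI impI)
    fix g l assume "(\<forall>k. g k \<in> D) \<and> g \<longlonglongrightarrow> l"
    then have g: "\<And>k. g k \<in> D" "g \<longlonglongrightarrow> l" by auto
    have "fst (g k) \<in> \<nat>" for k using g(1)[of k] by (auto simp: D_def)
    then have l: "fst l \<in> \<nat>"
      by (rule closed_sequentially[OF closed_Nats _ tendsto_fst[OF g(2)]])
    then obtain n where n: "fst l = real n" by (auto elim: Nats_cases)
    have "eventually (\<lambda>k. dist (fst (g k)) (fst l) < 1) sequentially"
      by (intro tendstoD[OF tendsto_fst] g) simp
    then have "eventually (\<lambda>k. snd (g k) \<in> C n) sequentially"
    proof eventually_elim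
      case (elim k)
      obtain j s where "g k = (real j, s)" "s \<in> C j" using g(1)[of k] by (auto simp: D_def)
      moreover from this elim n have "real j = real n"
        by (intro Nats_eq_if_dist_less_one) auto
      ultimately show ?case by simp
    qed
    then have "snd l \<in> C n"
      by (intro Lim_in_closed_set[OF C(1) _ _ tendsto_snd[OF g(2)]]) auto
    with n show "l \<in> D" by (cases l) (auto simp: D_def)
  qed
  moreover have "continuous_on D f"
    unfolding continuous_on_def
  proof
    fix w assume w: "w \<in> D"
    then obtain n s where ns: "w = (real n, s)" "s \<in> C n" by (auto simp: D_def)
    have "continuous_on ({real n} \<times> C n) (\<lambda>z. \<phi> n (snd z))"
      by (intro continuous_on_compose2[OF C(2)[of n]] continuous_intros) auto
    then have "((\<lambda>z. \<phi> n (snd z)) \<longlongrightarrow> \<phi> n (snd w)) (at w within {real n} \<times> C n)"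
      using ns by (auto simp: continuous_on_def)
    moreover have "at w within D = at w within {real n} \<times> C n"
    proof (rule at_within_nhd[of w "{z. dist (fst z) (real n) < 1}"])
      show "open {z :: real \<times> (nat \<Rightarrow> real). dist (fst z) (real n) < 1}"
        by (intro open_Collect_less continuous_intros)
      show "D \<inter> {z. dist (fst z) (real n) < 1} - {w} =
          {real n} \<times> C n \<inter> {z. dist (fst z) (real n) < 1} - {w}"
        using Nats_eq_if_dist_less_one[OF of_nat_in_Nats of_nat_in_Nats] by (fastforce simp: D_def)
    qed (use ns in auto)
    ultimately have "((\<lambda>z. \<phi> n (snd z)) \<longlongrightarrow> f w) (at w within D)"
      using ns by (simp add: f_def)
    then show "(f \<longlongrightarrow> f w) (at w within D)"
    proof (rule Lim_transform_eventually)
      show "eventually (\<lambda>z. \<phi> n (snd z) = f z) (at w within D)"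
        using near[OF w] by eventually_elim (use ns in \<open>auto simp: f_def split_beta\<close>)
    qed
  qed
  then have "analytic_in euclidean (f ` D)"
    using \<open>closed D\<close> by (intro analytic_in_image_closed) auto
  moreover have "f ` D = (\<Union>n. A n)"
  proof -
    have "f ` ({real n} \<times> C n) = A n" for n
    proof -
      have "f ` ({real n} \<times> C n) = \<phi> n ` C n"
        by (auto simp: f_def image_iff)
      then show ?thesis by (simp only: C(3))
    qed
    then show ?thesis by (simp add: D_def image_UN)
  qed
  ultimately show ?thesis by simp
qed

text \<open>The intersection is the image of the fibre product of the parametrizations, which is
  closed because the space is Hausdorff.\<close>

lemma analytic_in_INT:
  fixes A :: "nat \<Rightarrow> 'b::t2_space set"
  assumes "\<And>n. analytic_in euclidean (A n)"
  shows "analytic_in euclidean (\<Inter>n. A n)"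
proof -
  obtain C :: "nat \<Rightarrow> (nat \<Rightarrow> real) set" and \<phi> where
    C: "\<And>n. closed (C n)" "\<And>n. continuous_on (C n) (\<phi> n)" "\<And>n. \<phi> n ` C n = A n"
  proof -
    have "\<exists>C \<phi>. closed (C :: (nat \<Rightarrow> real) set) \<and> continuous_on C \<phi> \<and> \<phi> ` C = A n" for n
      using assms[of n] by (auto simp: analytic_in_def)
    then show thesis using that by metis
  qed
  define E where "E = {s :: nat \<Rightarrow> nat \<Rightarrow> real. \<forall>n. s n \<in> C n}"
  define D where "D = {s \<in> E. \<forall>n. \<phi> n (s n) = \<phi> 0 (s 0)}"
  have "E = (\<Inter>n. (\<lambda>s. s n) -` C n)" by (auto simp: E_def)
  moreover have "closed ((\<lambda>s :: nat \<Rightarrow> nat \<Rightarrow> real. s n) -` C n)" for n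
    by (intro closed_vimage C(1) continuous_on_product_coordinates)
  ultimately have "closed E" by auto
  have cont: "continuous_on E (\<lambda>s. \<phi> n (s n))" for n
    by (rule continuous_on_compose2[OF C(2)[of n]])
      (auto simp: E_def intro: continuous_on_subset[OF continuous_on_product_coordinates])
  have "D = E \<inter> (\<Inter>n. {s \<in> E. \<phi> n (s n) = \<phi> 0 (s 0)})"
    by (auto simp: D_def)
  moreover have "closed {s \<in> E. \<phi> n (s n) = \<phi> 0 (s 0)}" for n
  proof -
    have "closed (E \<inter> (\<lambda>s. (\<phi> n (s n), \<phi> 0 (s 0))) -` {z. fst z = snd z})"
      by (intro continuous_closed_preimage continuous_on_Pair cont \<open>closed E\<close>
          closed_Collect_eq continuous_intros)
    then show ?thesis by (simp add: vimage_def Int_def)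
  qed
  ultimately have "closed D" using \<open>closed E\<close> by auto
  have "continuous_on D (\<lambda>s. \<phi> 0 (s 0))"
    by (rule continuous_on_subset[OF cont]) (auto simp: D_def)
  then have "analytic_in euclidean ((\<lambda>s. \<phi> 0 (s 0)) ` D)"
    using \<open>closed D\<close> by (intro analytic_in_image_closed) auto
  moreover have "(\<lambda>s. \<phi> 0 (s 0)) ` D = (\<Inter>n. A n)"
  proof (intro subset_antisym subsetI)
    fix y assume "y \<in> (\<lambda>s. \<phi> 0 (s 0)) ` D"
    then obtain s where s: "s \<in> D" "y = \<phi> 0 (s 0)" by blast
    have "y \<in> A n" for n
    proof -
      have "s n \<in> C n" "\<phi> n (s n) = y"
        using s unfolding D_def E_def mem_Collect_eq by simp_all
      then show ?thesis unfolding C(3)[of n, symmetric] by blast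
    qed
    then show "y \<in> (\<Inter>n. A n)" by blast
  next
    fix y assume "y \<in> (\<Inter>n. A n)"
    then have "\<exists>s. \<forall>n. s n \<in> C n \<and> \<phi> n (s n) = y"
      using C(3) by (intro choice) force
    then obtain s where s: "\<And>n. s n \<in> C n \<and> \<phi> n (s n) = y" by blast
    then have "s \<in> D" by (simp add: D_def E_def)
    then show "y \<in> (\<lambda>s. \<phi> 0 (s 0)) ` D"
      using s[of 0] by (intro image_eqI[of _ _ s]) simp_all
  qed
  ultimately show ?thesis by simp
qed

lemma analytic_in_borel:
  fixes B :: "'p::polish_space set"
  assumes "B \<in> sets borel"
  shows "analytic_in euclidean B"
proof -
  have "B \<in> sigma_sets UNIV (Collect open)"
    using assms by (simp add: borel_def)
  then have "analytic_in euclidean B \<and> analytic_in euclidean (- B)"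
  proof induction
    case (Basic U)
    then have "fsigma_in euclidean U"
      by (intro open_imp_fsigma_in metrizable_space_euclidean) auto
    then obtain F :: "nat \<Rightarrow> 'p set" where "\<And>n. closed (F n)" "\<Union> (range F) = U"
      by (auto simp: fsigma_in_ascending)
    then have "analytic_in euclidean U"
      using analytic_in_UN[of F] analytic_in_closed by blast
    with Basic show ?case by (auto intro!: analytic_in_closed)
  next
    case Empty
    show ?case by (auto intro!: analytic_in_closed)
  next
    case (Compl a)
    then show ?case by (simp add: Compl_eq_Diff_UNIV[symmetric])
  next
    case (Union a)
    then have "analytic_in euclidean (\<Union>i. a i)" "analytic_in euclidean (\<Inter>i. - a i)"
      by (intro analytic_in_UN analytic_in_INT; simp)+
    then show ?case by simp
  qed
  then show ?thesis by simp
qed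

lemma compact_Pi_intervals: "compact {s :: nat \<Rightarrow> real. \<forall>i. s i \<in> {a i..b i}}"
proof -
  have "compactin (product_topology (\<lambda>i. euclidean) UNIV) (PiE UNIV (\<lambda>i. {a i..b i}))"
    unfolding compactin_PiE by simp
  then show ?thesis
    by (simp add: euclidean_product_topology PiE_UNIV_domain Pi_def)
qed

text \<open>The boxes that constrain only the first \<open>n\<close> coordinates are not compact, unlike the box
  that constrains all of them.  Points of the former are therefore cut off after \<open>n\<close>
  coordinates, which does not affect limits in the product topology.\<close>

lemma partial_box_subset_open:
  fixes W :: "(nat \<Rightarrow> real) set"
  assumes "open W" "{s. \<forall>i. \<bar>s i\<bar> \<le> b i} \<subseteq> W" "\<And>i. 0 \<le> b i"
  shows "\<exists>n. {s. \<forall>i<n. \<bar>s i\<bar> \<le> b i} \<subseteq> W"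
proof (rule ccontr)
  assume "\<not> ?thesis"
  then have "\<exists>s. \<forall>n. (\<forall>i<n. \<bar>s n i\<bar> \<le> b i) \<and> s n \<notin> W"
    by (intro choice) blast
  then obtain s where s: "\<And>n i. i < n \<Longrightarrow> \<bar>s n i\<bar> \<le> b i" "\<And>n. s n \<notin> W" by blast
  define K where "K = {s. \<forall>i. \<bar>s i\<bar> \<le> b i}"
  have "K = {s. \<forall>i. s i \<in> {- b i..b i}}" by (auto simp: K_def abs_le_iff minus_le_iff)
  then have "seq_compact K"
    using compact_imp_seq_compact[OF compact_Pi_intervals[of "\<lambda>i. - b i" b]] by simp
  moreover define s' where "s' n = (\<lambda>i. if i < n then s n i else 0)" for n
  have "s' n \<in> K" for n using s(1) assms(3) by (auto simp: K_def s'_def)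
  ultimately obtain l r where l: "l \<in> K" "strict_mono r" "(s' \<circ> r) \<longlonglongrightarrow> l"
    unfolding seq_compact_def by blast
  have "(s \<circ> r) \<longlonglongrightarrow> l"
    unfolding tendsto_fun_iff
  proof
    fix i
    show "(\<lambda>k. (s \<circ> r) k i) \<longlonglongrightarrow> l i"
    proof (rule Lim_transform_eventually[OF tendsto_coordinate[OF l(3), of i]])
      have "eventually (\<lambda>k. i < r k) sequentially"
        using l(2) seq_suble by (intro eventually_sequentiallyI[of "Suc i"]) (meson Suc_le_lessD le_trans)
      then show "eventually (\<lambda>k. (s' \<circ> r) k i = (s \<circ> r) k i) sequentially"
        by eventually_elim (simp add: s'_def)
    qed
  qed
  then have "l \<in> - W"
    by (rule closed_sequentially[rotated 2]) (use assms(1) s(2) in auto)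
  with l(1) assms(2) show False by (auto simp: K_def)
qed

lemma openin_in_sets_borel_algebra: "openin T U \<Longrightarrow> U \<in> sets (borel_algebra T)"
  unfolding borel_algebra_def using openin_subset[of T]
  by (subst sets_measure_of) (auto intro: sigma_sets.Basic)

lemma closedin_in_sets_borel_algebra:
  assumes "closedin T F"
  shows "F \<in> sets (borel_algebra T)"
proof -
  have "space (borel_algebra T) - (topspace T - F) \<in> sets (borel_algebra T)"
    using assms by (intro sets.compl_sets openin_in_sets_borel_algebra) (simp add: closedin_def)
  then show ?thesis
    using closedin_subset[OF assms] by (simp add: space_borel_algebra double_diff)
qed

text \<open>Inner regularity of analytic sets with respect to the outer measure.  The bounds \<open>k i\<close>
  are chosen one coordinate at a time, so that restricting the first \<open>n\<close> coordinates by
  \<open>\<bar>s i\<bar> \<le> k i\<close> keeps the outer measure of the image above \<open>t\<close> for every \<open>n\<close>; this uses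
  continuity from below of the outer measure.  The image of the compact box is the intersection of the closures of the images
  of the partial boxes, and this is where the Hausdorff property is used.\<close>

lemma analytic_in_inner_closed:
  fixes \<mu> :: "'b measure"
  assumes "Hausdorff_space T" "analytic_in T A"
    and \<mu>: "finite_measure \<mu>" "sets \<mu> = sets (borel_algebra T)"
    and t: "t < outer_measure_of \<mu> A"
  shows "\<exists>F. closedin T F \<and> F \<subseteq> A \<and> t \<le> emeasure \<mu> F"
proof -
  interpret finite_measure \<mu> by fact
  have space: "space \<mu> = topspace T"
    using sets_eq_imp_space_eq[OF \<mu>(2)] by (simp add: space_borel_algebra)
  have closedin_sets: "F \<in> sets \<mu>" if "closedin T F" for F
    unfolding \<mu>(2) using that by (rule closedin_in_sets_borel_algebra)
  obtain C :: "(nat \<Rightarrow> real) set" and \<phi> where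
    C: "closed C" "continuous_map (top_of_set C) T \<phi>" "\<phi> ` C = A"
    using assms(2) unfolding analytic_in_def by blast
  have \<phi>_top: "\<phi> ` D \<subseteq> topspace T" if "D \<subseteq> C" for D
    using C(2) that by (auto simp: continuous_map_def)
  define B where "B k n = {s \<in> C. \<forall>i<n. \<bar>s i\<bar> \<le> real (k i)}" for k :: "nat \<Rightarrow> nat" and n
  have BC: "B k n \<subseteq> C" for k n by (auto simp: B_def)
  have "\<exists>f. \<forall>n. t < outer_measure_of \<mu> (\<phi> ` B (f n) n) \<and> (\<forall>i<n. f (Suc n) i = f n i)"
  proof (rule dependent_nat_choice)
    show "\<exists>k. t < outer_measure_of \<mu> (\<phi> ` B k 0)"
      using t C(3) by (simp add: B_def)
  next
    fix k n assume k: "t < outer_measure_of \<mu> (\<phi> ` B k n)"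
    have "incseq (\<lambda>j. \<phi> ` B (k(n := j)) (Suc n))"
      by (intro monoI image_mono) (force simp: B_def)
    then have "(SUP j. outer_measure_of \<mu> (\<phi> ` B (k(n := j)) (Suc n))) =
        outer_measure_of \<mu> (\<Union>j. \<phi> ` B (k(n := j)) (Suc n))"
      using \<phi>_top[OF BC] space by (intro SUP_outer_measure_of_incseq) auto
    also have "(\<Union>j. \<phi> ` B (k(n := j)) (Suc n)) = \<phi> ` (\<Union>j. B (k(n := j)) (Suc n))"
      by blast
    also have "(\<Union>j. B (k(n := j)) (Suc n)) = B k n"
    proof (intro subset_antisym subsetI)
      fix s assume s: "s \<in> B k n"
      obtain j where "\<bar>s n\<bar> \<le> real j" using real_arch_simple by blast
      with s have "s \<in> B (k(n := j)) (Suc n)" by (auto simp: B_def less_Suc_eq)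
      then show "s \<in> (\<Union>j. B (k(n := j)) (Suc n))" by blast
    qed (auto simp: B_def less_Suc_eq)
    finally have "t < (SUP j. outer_measure_of \<mu> (\<phi> ` B (k(n := j)) (Suc n)))"
      using k by (simp only:)
    then obtain j where "t < outer_measure_of \<mu> (\<phi> ` B (k(n := j)) (Suc n))"
      unfolding less_SUP_iff by blast
    then show "\<exists>k'. t < outer_measure_of \<mu> (\<phi> ` B k' (Suc n)) \<and> (\<forall>i<n. k' i = k i)"
      by (intro exI[of _ "k(n := j)"]) auto
  qed
  then obtain f where f: "\<And>n. t < outer_measure_of \<mu> (\<phi> ` B (f n) n)"
    "\<And>n i. i < n \<Longrightarrow> f (Suc n) i = f n i" by blast
  define k where "k i = f (Suc i) i" for i
  have fk: "f n i = k i" if "i < n" for n i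
    using that
  proof (induction n)
    case (Suc n)
    then show ?case by (cases "i = n") (simp_all add: k_def f(2))
  qed simp
  have "B (f n) n = B k n" for n
    unfolding B_def using fk by auto
  with f(1) have big: "t < outer_measure_of \<mu> (\<phi> ` B k n)" for n by simp
  define K where "K = {s \<in> C. \<forall>i. \<bar>s i\<bar> \<le> real (k i)}"
  have "K = C \<inter> {s. \<forall>i. s i \<in> {- real (k i)..real (k i)}}"
    by (auto simp: K_def abs_le_iff minus_le_iff)
  then have "compact K"
    using closed_Int_compact[OF C(1) compact_Pi_intervals] by simp
  then have "compactin (top_of_set C) K"
    by (auto simp: compactin_subtopology K_def)
  then have comp: "compactin T (\<phi> ` K)"
    using C(2) image_compactin by blast
  define L where "L n = T closure_of (\<phi> ` B k n)" for n
  have sub: "\<phi> ` B k n \<subseteq> L n" for n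
    unfolding L_def by (rule closure_of_subset[OF \<phi>_top[OF BC]])
  have LK: "(\<Inter>n. L n) = \<phi> ` K"
  proof (rule subset_antisym)
    have "K \<subseteq> B k n" for n by (auto simp: K_def B_def)
    then show "\<phi> ` K \<subseteq> (\<Inter>n. L n)" using sub by blast
    show "(\<Inter>n. L n) \<subseteq> \<phi> ` K"
    proof (rule subsetI, rule ccontr)
      fix y assume y: "y \<in> (\<Inter>n. L n)" "y \<notin> \<phi> ` K"
      then have yT: "y \<in> topspace T" by (auto simp: L_def in_closure_of)
      then obtain U V where UV: "openin T U" "openin T V" "\<phi> ` K \<subseteq> U" "y \<in> V" "disjnt U V"
        using Hausdorff_space_compact_separation[OF assms(1) comp, of "{y}"] y(2)
        by (auto simp: disjnt_def)
      have "openin (top_of_set C) {s \<in> C. \<phi> s \<in> U}"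
        using openin_continuous_map_preimage[OF C(2) UV(1)] by simp
      then obtain W where W: "open W" "{s \<in> C. \<phi> s \<in> U} = C \<inter> W"
        by (auto simp: openin_open)
      have "{s. \<forall>i. \<bar>s i\<bar> \<le> real (k i)} \<subseteq> W \<union> - C"
      proof
        fix s assume "s \<in> {s. \<forall>i. \<bar>s i\<bar> \<le> real (k i)}"
        then have "s \<in> C \<Longrightarrow> s \<in> K" by (simp add: K_def)
        then have "s \<in> C \<Longrightarrow> \<phi> s \<in> U" using UV(3) by blast
        then show "s \<in> W \<union> - C" using W(2) by blast
      qed
      moreover have "open (W \<union> - C)" using W(1) C(1) by auto
      ultimately obtain n where "{s. \<forall>i<n. \<bar>s i\<bar> \<le> real (k i)} \<subseteq> W \<union> - C"
        using partial_box_subset_open[of "W \<union> - C" "\<lambda>i. real (k i)"] by auto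
      then have "B k n \<subseteq> W" by (auto simp: B_def)
      then have "\<phi> ` B k n \<subseteq> U" using W(2) BC[of k n] by blast
      moreover have "y \<in> T closure_of (\<phi> ` B k n)" using y(1) by (simp add: L_def)
      then obtain z where "z \<in> \<phi> ` B k n" "z \<in> V"
        unfolding in_closure_of using UV(2,4) by blast
      ultimately show False
        using UV(5) by (auto simp: disjnt_def)
    qed
  qed
  have clL: "closedin T (L n)" for n by (simp add: L_def)
  have "decseq L"
    unfolding decseq_def L_def by (intro allI impI closure_of_mono image_mono) (auto simp: B_def)
  then have "(INF n. emeasure \<mu> (L n)) = emeasure \<mu> (\<Inter>n. L n)"
    using closedin_sets[OF clL] by (intro INF_emeasure_decseq) auto
  moreover have "t \<le> emeasure \<mu> (L n)" for n
  proof -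
    have "t < outer_measure_of \<mu> (L n)"
      using big[of n] outer_measure_of_mono[OF sub[of n], of \<mu>] by simp
    then show ?thesis using closedin_sets[OF clL[of n]] by simp
  qed
  ultimately have "t \<le> emeasure \<mu> (\<phi> ` K)"
    unfolding LK by (metis (no_types, lifting) INF_greatest)
  moreover have "closedin T (\<phi> ` K)"
    using compactin_imp_closedin[OF assms(1) comp] .
  moreover have "\<phi> ` K \<subseteq> A" using C(3) by (auto simp: K_def)
  ultimately show ?thesis by blast
qed

text \<open>Inner approximation by closed sets and outer approximation by a measurable hull differ by
  a null set.\<close>

theorem analytic_in_universally_measurable:
  assumes "Hausdorff_space T" "analytic_in T A"
  shows "universally_measurable T A"
  unfolding universally_measurable_def
proof (intro conjI allI impI)
  show AT: "A \<subseteq> topspace T"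
    using assms(2) by (auto simp: analytic_in_def continuous_map_def)
  fix \<mu> :: "'a measure" assume \<mu>: "finite_measure \<mu>" "sets \<mu> = sets (borel_algebra T)"
  interpret finite_measure \<mu> by fact
  have space: "space \<mu> = topspace T"
    using sets_eq_imp_space_eq[OF \<mu>(2)] by (simp add: space_borel_algebra)
  have closedin_sets: "F \<in> sets \<mu>" if "closedin T F" for F
    unfolding \<mu>(2) using that by (rule closedin_in_sets_borel_algebra)
  obtain E where E: "E \<in> sets \<mu>" "A \<subseteq> E" "outer_measure_of \<mu> A = emeasure \<mu> E"
    using outer_measure_of_attain[of A \<mu>] AT space by auto
  have "\<exists>F. closedin T F \<and> F \<subseteq> A \<and> emeasure \<mu> E \<le> emeasure \<mu> F + ennreal (1 / Suc n)" for n
  proof (cases "emeasure \<mu> E = 0")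
    case False
    have "emeasure \<mu> E - ennreal (1 / Suc n) < emeasure \<mu> E"
      using False unfolding emeasure_eq_measure
      by (simp add: ennreal_minus zero_less_measure_iff ennreal_lessI)
    then obtain F where F: "closedin T F" "F \<subseteq> A" "emeasure \<mu> E - ennreal (1 / Suc n) \<le> emeasure \<mu> F"
      using analytic_in_inner_closed[OF assms \<mu>] E(3) by metis
    then have "emeasure \<mu> E \<le> emeasure \<mu> F + ennreal (1 / Suc n)"
      by (metis add.commute ennreal_minus_le_iff ennreal_neq_top)
    with F show ?thesis by blast
  qed (auto intro!: exI[of _ "{}"])
  then obtain F where F: "\<And>n. closedin T (F n)" "\<And>n. F n \<subseteq> A"
    "\<And>n. emeasure \<mu> E \<le> emeasure \<mu> (F n) + ennreal (1 / Suc n)" by metis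
  define G where "G = (\<Union>n. F n)"
  have G: "G \<in> sets \<mu>" "G \<subseteq> A" using F(1,2) closedin_sets by (auto simp: G_def)
  have "emeasure \<mu> E \<le> emeasure \<mu> G"
  proof (rule ennreal_le_epsilon)
    fix e :: real assume "e > 0"
    then obtain n where "1 / Suc n < e" using nat_approx_posE by blast
    have "emeasure \<mu> E \<le> emeasure \<mu> (F n) + ennreal (1 / Suc n)" by (rule F(3))
    also have "\<dots> \<le> emeasure \<mu> G + ennreal e"
      using \<open>1 / Suc n < e\<close> G(1) by (intro add_mono emeasure_mono ennreal_leI) (auto simp: G_def)
    finally show "emeasure \<mu> E \<le> emeasure \<mu> G + ennreal e" .
  qed
  then have "E - G \<in> null_sets \<mu>"
    using E(1,2) G emeasure_finite[of G] emeasure_finite[of E]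
    by (intro null_setsI) (auto simp: emeasure_Diff diff_eq_0_iff_ennreal less_top[symmetric])
  then show "A \<in> sets (completion \<mu>)"
    using E(2) G by (intro sets_completionI[of A G "A - G" "E - G"]) auto
qed

section \<open>Configurations as marked sequences\<close>

text \<open>Indices of the points of a configuration with \<open>N\<close> points, \<open>N = \<infinity>\<close> included.\<close>

definition indices :: "enat \<Rightarrow> nat set" where
  "indices N = {i. enat i < N}"

text \<open>The sum of the Dirac measures at the first \<open>N\<close> points of the sequence \<open>x\<close>: counting
  measure on the indices, pushed forward by \<open>x\<close>.\<close>

definition configuration_of :: "'a measure \<Rightarrow> enat \<Rightarrow> (nat \<Rightarrow> 'a) \<Rightarrow> 'a measure" where
  "configuration_of m N x = distr (count_space (indices N)) m x"

text \<open>A sequence of points and a sequence of real bounds; the bounds are real rather than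
  natural so that codes form a Polish space without further structure on the naturals.\<close>

type_synonym 'a code = "(nat \<Rightarrow> 'a) \<times> (nat \<Rightarrow> real)"

text \<open>A code \<open>(x, c)\<close> describes a configuration of \<open>N\<close> points together with a witness \<open>c\<close>
  of local finiteness: the points in the open ball of radius \<open>n\<close> around \<open>p\<close> have index at
  most \<open>c n\<close>.  Recording the witness makes the set of codes closed, and it makes the map
  \<open>(x, c) \<mapsto> configuration_of m N x\<close> vaguely continuous, because the integral of a function
  vanishing outside that ball is, where \<open>c n < k\<close>, a sum over the fixed finite set of
  indices below \<open>k\<close>.\<close>

definition marked_sequences :: "'a::metric_space \<Rightarrow> enat \<Rightarrow> 'a code set" where
  "marked_sequences p N = {(x, c). \<forall>n. \<forall>i\<in>indices N. c n < real i \<longrightarrow> real n \<le> dist p (x i)}"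

lemma countable_indices [simp]: "countable (indices N)"
  by (rule countable_subset[OF subset_UNIV]) simp

lemma sigma_finite_count_space_indices [simp]: "sigma_finite_measure (count_space (indices N))"
  by (rule sigma_finite_measure_count_space_countable) simp

lemma continuous_on_fst_apply:
  "continuous_on S (\<lambda>z :: ('i \<Rightarrow> 'b::topological_space) \<times> 'c::topological_space. fst z i)"
  by (rule continuous_on_product_then_coordinatewise[OF continuous_on_fst[OF continuous_on_id]])

lemma continuous_on_snd_apply:
  "continuous_on S (\<lambda>z :: 'c::topological_space \<times> ('i \<Rightarrow> 'b::topological_space). snd z i)"
  by (rule continuous_on_product_then_coordinatewise[OF continuous_on_snd[OF continuous_on_id]])

lemma closed_marked_sequences: "closed (marked_sequences p N)"
proof -
  have "marked_sequences p N =
      (\<Inter>n. \<Inter>i\<in>indices N. {z. real i \<le> snd z n \<or> real n \<le> dist p (fst z i)})"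
  proof (rule set_eqI)
    fix z :: "'a code"
    show "z \<in> marked_sequences p N \<longleftrightarrow>
        z \<in> (\<Inter>n. \<Inter>i\<in>indices N. {z. real i \<le> snd z n \<or> real n \<le> dist p (fst z i)})"
      by (cases z) (simp add: marked_sequences_def, metis not_less)
  qed
  also have "closed \<dots>"
    by (intro closed_INT ballI closed_Collect_disj closed_Collect_le continuous_on_const
        continuous_on_dist continuous_on_fst_apply continuous_on_snd_apply)
  finally show ?thesis .
qed

context metric_local_structure
begin

lemma borel_in_sets [intro]: "A \<in> sets borel \<Longrightarrow> A \<in> sets m"
  using borel_subset_sets by blast

lemma closed_in_sets [intro]: "closed A \<Longrightarrow> A \<in> sets m"
  by (intro borel_in_sets borel_closed)

lemma open_in_sets [intro]: "open A \<Longrightarrow> A \<in> sets m"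
  by (intro borel_in_sets borel_open)

lemma countable_in_sets: "countable A \<Longrightarrow> A \<in> sets m"
  by (rule sets.countable) (auto intro: closed_in_sets)

lemma measurable_borel: "f \<in> measurable borel L \<Longrightarrow> f \<in> measurable m L"
  by (rule measurable_mono[THEN subsetD, of L L borel m])
    (use borel_subset_sets in \<open>auto simp: space_UNIV\<close>)

lemma sets_configuration_of [simp]: "sets (configuration_of m N x) = sets m"
  by (simp add: configuration_of_def)

lemma space_configuration_of [simp]: "space (configuration_of m N x) = UNIV"
  by (simp add: configuration_of_def space_UNIV)

lemma emeasure_configuration_of:
  "A \<in> sets m \<Longrightarrow>
    emeasure (configuration_of m N x) A = emeasure (count_space (indices N)) (x -` A \<inter> indices N)"
  unfolding configuration_of_def by (subst emeasure_distr) (simp_all add: space_UNIV)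

lemma nn_integral_configuration_of:
  "f \<in> borel_measurable m \<Longrightarrow>
    (\<integral>\<^sup>+a. f a \<partial>configuration_of m N x) = (\<integral>\<^sup>+i. f (x i) \<partial>count_space (indices N))"
  unfolding configuration_of_def by (subst nn_integral_distr) (simp_all add: space_UNIV)

lemma emeasure_configuration_of_eq_suminf:
  assumes "A \<in> sets m"
  shows "emeasure (configuration_of m N x) A =
    (\<Sum>i. if enat i < N then emeasure (return m (x i)) A else 0)"
proof -
  have "emeasure (configuration_of m N x) A = (\<integral>\<^sup>+a. indicator A a \<partial>configuration_of m N x)"
    using assms by simp
  also have "\<dots> = (\<integral>\<^sup>+i. indicator A (x i) \<partial>count_space (indices N))"
    using assms by (intro nn_integral_configuration_of) simp
  also have "\<dots> = (\<integral>\<^sup>+i. indicator A (x i) * indicator (indices N) i \<partial>count_space UNIV)"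
    by (simp add: nn_integral_count_space_indicator)
  also have "\<dots> = (\<Sum>i. indicator A (x i) * indicator (indices N) i)"
    by (rule nn_integral_count_space_nat)
  also have "\<dots> = (\<Sum>i. if enat i < N then emeasure (return m (x i)) A else 0)"
    using assms by (intro suminf_cong) (simp add: indices_def emeasure_return indicator_def)
  finally show ?thesis .
qed

lemma configurations_iff:
  "\<gamma> \<in> configurations m \<longleftrightarrow>
    (\<exists>N x. \<gamma> = configuration_of m N x) \<and> (\<forall>E\<in>bounded_ring m. emeasure \<gamma> E < \<infinity>)"
proof -
  have "(sets \<gamma> = sets m \<and> (\<forall>A\<in>sets m. emeasure \<gamma> A =
      (\<Sum>i. if enat i < N then emeasure (return m (x i)) A else 0))) \<longleftrightarrow>
      \<gamma> = configuration_of m N x" for N and x :: "nat \<Rightarrow> 'a"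
    by (auto simp: emeasure_configuration_of_eq_suminf intro: measure_eqI)
  then show ?thesis unfolding configurations_def by blast
qed

lemma sets_configurations: "\<gamma> \<in> configurations m \<Longrightarrow> sets \<gamma> = sets m"
  unfolding configurations_def by blast

lemma emeasure_bounded_finite:
  "\<gamma> \<in> configurations m \<Longrightarrow> E \<in> sets m \<Longrightarrow> bounded E \<Longrightarrow> emeasure \<gamma> E < \<infinity>"
  unfolding configurations_def bounded_ring_def by blast

lemma finite_indices_of_bounded:
  assumes "(x, c) \<in> marked_sequences p N" "E \<subseteq> ball p (real n)"
  shows "i \<in> indices N \<Longrightarrow> x i \<in> E \<Longrightarrow> real i \<le> c n" and "finite {i \<in> indices N. x i \<in> E}"
proof -
  show le: "real i \<le> c n" if "i \<in> indices N" "x i \<in> E" for i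
  proof (rule ccontr)
    assume "\<not> ?thesis"
    then have "real n \<le> dist p (x i)"
      using assms(1) that by (auto simp: marked_sequences_def)
    then show False using assms(2) that by auto
  qed
  obtain k where "c n < real k" using reals_Archimedean2 by blast
  then have "{i \<in> indices N. x i \<in> E} \<subseteq> {..<k}"
    using le by fastforce
  then show "finite {i \<in> indices N. x i \<in> E}" by (rule finite_subset) simp
qed

lemma configuration_of_in_configurations:
  assumes "(x, c) \<in> marked_sequences p N"
  shows "configuration_of m N x \<in> configurations m"
  unfolding configurations_iff
proof (intro conjI ballI)
  fix E assume E: "E \<in> bounded_ring m"
  then obtain n where n: "E \<subseteq> ball p (real n)"
    using bounded_subset_ballD[of E p] reals_Archimedean2 subset_ball
    by (metis (no_types, lifting) bounded_ring_def less_imp_le mem_Collect_eq order_trans)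
  have "x -` E \<inter> indices N = {i \<in> indices N. x i \<in> E}" by auto
  then show "emeasure (configuration_of m N x) E < \<infinity>"
    using E finite_indices_of_bounded(2)[OF assms n]
    by (simp add: emeasure_configuration_of bounded_ring_def emeasure_count_space
        of_nat_less_top)
qed blast

lemma configurations_marked:
  assumes "\<gamma> \<in> configurations m"
  obtains N x c where "\<gamma> = configuration_of m N x" "(x, c) \<in> marked_sequences p N"
proof -
  obtain N x where \<gamma>: "\<gamma> = configuration_of m N x"
    using assms unfolding configurations_iff by blast
  have "\<exists>k. \<forall>i\<in>indices N. dist p (x i) < real n \<longrightarrow> real i \<le> k" for n
  proof -
    have "emeasure (configuration_of m N x) (ball p (real n)) < \<infinity>"
      using emeasure_bounded_finite[OF assms] \<gamma> by blast
    then have "finite (x -` ball p (real n) \<inter> indices N)"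
      by (simp add: emeasure_configuration_of open_in_sets emeasure_count_space split: if_splits)
    then obtain k where "\<forall>i\<in>x -` ball p (real n) \<inter> indices N. i \<le> k"
      using finite_nat_set_iff_bounded_le by blast
    then show ?thesis by (intro exI[of _ "real k"]) auto
  qed
  then obtain c where "\<And>n i. i \<in> indices N \<Longrightarrow> dist p (x i) < real n \<Longrightarrow> real i \<le> c n"
    by metis
  then have "(x, c) \<in> marked_sequences p N"
    unfolding marked_sequences_def by (auto simp: not_less[symmetric])
  with \<gamma> show thesis by (rule that)
qed

lemma integral_configuration_of_eq_sum:
  fixes f :: "'a \<Rightarrow> real"
  assumes "(x, c) \<in> marked_sequences p N" "c n < real k"
    and f: "f \<in> borel_measurable m" "\<And>a. a \<notin> ball p (real n) \<Longrightarrow> f a = 0"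
  shows "integral\<^sup>L (configuration_of m N x) f = (\<Sum>i\<in>indices N \<inter> {..<k}. f (x i))"
proof -
  have sub: "{i \<in> indices N. f (x i) \<noteq> 0} \<subseteq> indices N \<inter> {..<k}"
  proof
    fix i assume i: "i \<in> {i \<in> indices N. f (x i) \<noteq> 0}"
    then have "x i \<in> ball p (real n)" using f(2) by blast
    then have "real i \<le> c n"
      using finite_indices_of_bounded(1)[OF assms(1) subset_refl] i by blast
    with i assms(2) show "i \<in> indices N \<inter> {..<k}" by auto
  qed
  have "integral\<^sup>L (configuration_of m N x) f = (\<integral>i. f (x i) \<partial>count_space (indices N))"
    unfolding configuration_of_def using f(1)
    by (intro integral_distr) (simp_all add: space_UNIV)
  also have "\<dots> = (\<Sum>i | i \<in> indices N \<and> f (x i) \<noteq> 0. f (x i))"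
    by (rule lebesgue_integral_count_space_finite_support) (rule finite_subset[OF sub], simp)
  also have "\<dots> = (\<Sum>i\<in>indices N \<inter> {..<k}. f (x i))"
    by (rule sum.mono_neutral_left) (use sub in auto)
  finally show ?thesis .
qed

lemma bounded_support_continuous_measurable:
  "f \<in> bounded_support_continuous \<Longrightarrow> f \<in> borel_measurable m"
  by (auto simp: bounded_support_continuous_def
      intro!: measurable_borel borel_measurable_continuous_onI)

lemma continuous_map_configuration_of:
  "continuous_map (top_of_set (marked_sequences p N)) (vague_topology m)
     (\<lambda>(x, c). configuration_of m N x)"
  unfolding vague_topology_def
proof (rule continuous_on_generated_topo)
  let ?P = "marked_sequences p N" and ?\<psi> = "\<lambda>(x, c). configuration_of m N x"
  fix V assume "V \<in> {{\<gamma> \<in> configurations m. integral\<^sup>L \<gamma> f \<in> U} | f U.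
      f \<in> bounded_support_continuous \<and> open U}"
  then obtain f U where V: "V = {\<gamma> \<in> configurations m. integral\<^sup>L \<gamma> f \<in> U}"
    and f: "f \<in> bounded_support_continuous" and "open U" by blast
  obtain B where "bounded B" and B: "\<And>a. a \<notin> B \<Longrightarrow> f a = 0"
    using f by (auto simp: bounded_support_continuous_def)
  then obtain e where "B \<subseteq> ball p e" using bounded_subset_ballD by blast
  moreover obtain n where "e < real n" using reals_Archimedean2 by blast
  ultimately have f0: "f a = 0" if "a \<notin> ball p (real n)" for a
    using that B subset_ball[of e "real n" p] by (metis less_imp_le subsetD)
  define S where "S k z = (\<Sum>i\<in>indices N \<inter> {..<k}. f (fst z i))"
    for k and z :: "'a code"
  have int: "integral\<^sup>L (?\<psi> z) f = S k z" if "z \<in> ?P" "snd z n < real k" for z k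
    using integral_configuration_of_eq_sum[of "fst z" "snd z" p N n k f] that f0
      bounded_support_continuous_measurable[OF f] by (simp add: S_def split_beta)
  have "?\<psi> -` V \<inter> ?P = ?P \<inter> (\<Union>k. {z. snd z n < real k} \<inter> S k -` U)"
  proof -
    have "?\<psi> z \<in> V \<longleftrightarrow> (\<exists>k. snd z n < real k \<and> S k z \<in> U)" if z: "z \<in> ?P" for z
    proof -
      have "?\<psi> z \<in> configurations m"
        using z configuration_of_in_configurations[of "fst z" "snd z" p N] by (simp add: split_beta)
      moreover obtain k where "snd z n < real k" using reals_Archimedean2 by blast
      ultimately show ?thesis using int[OF z] unfolding V by (metis (lifting) mem_Collect_eq)
    qed
    then show ?thesis by blast
  qed
  moreover have "open (\<Union>k. {z. snd z n < real k} \<inter> S k -` U)"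
  proof (rule open_UN, rule ballI, rule open_Int)
    fix k
    show "open {z :: 'a code. snd z n < real k}"
      by (rule open_Collect_less[OF continuous_on_snd_apply continuous_on_const])
    have "continuous_on UNIV f" using f by (simp add: bounded_support_continuous_def)
    then have "continuous_on UNIV (\<lambda>z :: 'a code. f (fst z i))" for i
      by (rule continuous_on_compose2[OF _ continuous_on_fst_apply]) simp
    then have "continuous_on UNIV (S k)"
      unfolding S_def by (intro continuous_on_sum)
    then show "open (S k -` U)" using \<open>open U\<close> by (rule open_vimage[rotated])
  qed
  ultimately show "openin (top_of_set ?P) (?\<psi> -` V \<inter> topspace (top_of_set ?P))"
    by (simp add: openin_open_Int)
next
  have "configurations m = \<Union> {{\<gamma> \<in> configurations m. integral\<^sup>L \<gamma> f \<in> U} | f U.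
      f \<in> bounded_support_continuous \<and> open U}"
    using topspace_vague_topology[of m]
    unfolding vague_topology_def topology_generated_by_topspace by simp
  then show "(\<lambda>(x, c). configuration_of m N x) ` topspace (top_of_set (marked_sequences p N)) \<subseteq>
      \<Union> {{\<gamma> \<in> configurations m. integral\<^sup>L \<gamma> f \<in> U} | f U.
      f \<in> bounded_support_continuous \<and> open U}"
    using configuration_of_in_configurations by auto
qed

section \<open>The vague topology is Hausdorff\<close>

text \<open>A configuration is carried by countably many points, so its values on singletons
  determine it on all of \<open>sets m\<close>, beyond the Borel sets.\<close>

lemma configurations_eqI:
  assumes "\<gamma> \<in> configurations m" "\<eta> \<in> configurations m"
    and eq: "\<And>a. emeasure \<gamma> {a} = emeasure \<eta> {a}"
  shows "\<gamma> = \<eta>"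
proof -
  obtain N x M y where \<gamma>: "\<gamma> = configuration_of m N x" and \<eta>: "\<eta> = configuration_of m M y"
    using assms unfolding configurations_iff by blast
  define S where "S = x ` indices N \<union> y ` indices M"
  have S: "countable S" by (simp add: S_def)
  show ?thesis
  proof (rule measure_eqI)
    fix A assume "A \<in> sets \<gamma>"
    then have A: "A \<in> sets m" by (simp add: \<gamma>)
    have AS: "countable (A \<inter> S)" using S by auto
    have "emeasure \<gamma> A = emeasure \<gamma> (A \<inter> S)"
    proof -
      have "x -` A \<inter> indices N = x -` (A \<inter> S) \<inter> indices N" by (auto simp: S_def)
      then show ?thesis
        using A countable_in_sets[OF AS] by (simp add: \<gamma> emeasure_configuration_of)
    qed
    also have "\<dots> = (\<integral>\<^sup>+a. emeasure \<gamma> {a} \<partial>count_space (A \<inter> S))"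
      using AS by (intro emeasure_countable_singleton) (auto simp: \<gamma>)
    also have "\<dots> = (\<integral>\<^sup>+a. emeasure \<eta> {a} \<partial>count_space (A \<inter> S))"
      by (simp add: eq)
    also have "\<dots> = emeasure \<eta> (A \<inter> S)"
      using AS by (intro emeasure_countable_singleton[symmetric]) (auto simp: \<eta>)
    also have "\<dots> = emeasure \<eta> A"
    proof -
      have "y -` A \<inter> indices M = y -` (A \<inter> S) \<inter> indices M" by (auto simp: S_def)
      then show ?thesis
        using A countable_in_sets[OF AS] by (simp add: \<eta> emeasure_configuration_of)
    qed
    finally show "emeasure \<gamma> A = emeasure \<eta> A" .
  qed (simp add: \<gamma> \<eta>)
qed

text \<open>The tent of height one at \<open>a\<close> whose support shrinks to \<open>{a}\<close> as \<open>k\<close> grows; \<open>Suc k\<close>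
  keeps the support inside the unit ball, also for \<open>k = 0\<close>.\<close>

definition tent :: "'a \<Rightarrow> nat \<Rightarrow> 'a \<Rightarrow> real" where
  "tent a k b = max 0 (1 - real (Suc k) * dist a b)"

lemma tent_bounds: "0 \<le> tent a k b" "tent a k b \<le> indicator (cball a 1) b"
proof -
  show "0 \<le> tent a k b" by (simp add: tent_def)
  have "1 \<le> real (Suc k) * dist a b" if "1 < dist a b"
    using that mult_mono[of 1 "real (Suc k)" 1 "dist a b"] by simp
  then show "tent a k b \<le> indicator (cball a 1) b"
    by (auto simp: tent_def indicator_def)
qed

lemma tent_in_bounded_support_continuous: "tent a k \<in> bounded_support_continuous"
proof -
  have "continuous_on UNIV (tent a k)"
    unfolding tent_def by (intro continuous_intros)
  moreover have "tent a k b \<in> {0..1}" for b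
    using tent_bounds(1)[of a k b] order_trans[OF tent_bounds(2) indicator_le_1, of a k b] by simp
  then have "bounded (range (tent a k))"
    by (intro bounded_subset[OF bounded_closed_interval[of 0 1]]) auto
  moreover have "tent a k b = 0" if "b \<notin> cball a 1" for b
    using tent_bounds[of a k b] that by (simp add: indicator_def)
  ultimately show ?thesis
    unfolding bounded_support_continuous_def
    by (auto intro!: exI[of _ "cball a 1"])
qed

lemma tent_tendsto_indicator: "(\<lambda>k. tent a k b) \<longlonglongrightarrow> indicator {a} b"
proof (cases "b = a")
  case True
  then show ?thesis by (simp add: tent_def)
next
  case False
  then have "0 < dist a b" by simp
  then obtain K where K: "1 < real K * dist a b"
    using reals_Archimedean3 by blast
  have "eventually (\<lambda>k. tent a k b = 0) sequentially"
  proof (rule eventually_sequentiallyI)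
    fix k assume "K \<le> k"
    then have "real K * dist a b \<le> real (Suc k) * dist a b"
      by (intro mult_right_mono) auto
    with K show "tent a k b = 0" by (simp add: tent_def)
  qed
  then show ?thesis using False by (simp add: tendsto_eventually)
qed

lemma integral_tent_tendsto:
  assumes "\<gamma> \<in> configurations m"
  shows "(\<lambda>k. integral\<^sup>L \<gamma> (tent a k)) \<longlonglongrightarrow> measure \<gamma> {a}"
proof -
  have sets: "sets \<gamma> = sets m" using assms by (rule sets_configurations)
  then have meas: "borel_measurable \<gamma> = borel_measurable m"
    by (rule measurable_cong_sets) simp
  have in_sets: "{a} \<in> sets \<gamma>" "cball a 1 \<in> sets \<gamma>" by (auto simp: sets)
  have "emeasure \<gamma> (cball a 1) < \<infinity>"
    using emeasure_bounded_finite[OF assms] by blast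
  then have "(\<lambda>k. integral\<^sup>L \<gamma> (tent a k)) \<longlonglongrightarrow> integral\<^sup>L \<gamma> (indicator {a})"
    using in_sets tent_bounds tent_tendsto_indicator
    by (intro integral_dominated_convergence[where w = "indicator (cball a 1)"])
      (auto simp: meas sets intro!: bounded_support_continuous_measurable
        tent_in_bounded_support_continuous)
  then show ?thesis using in_sets by simp
qed

lemma Hausdorff_vague_topology: "Hausdorff_space (vague_topology m)"
  unfolding Hausdorff_space_def topspace_vague_topology
proof (intro allI impI)
  fix \<gamma> \<eta> assume *: "\<gamma> \<in> configurations m \<and> \<eta> \<in> configurations m \<and> \<gamma> \<noteq> \<eta>"
  have "\<exists>f\<in>bounded_support_continuous. integral\<^sup>L \<gamma> f \<noteq> integral\<^sup>L \<eta> f"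
  proof (rule ccontr)
    assume "\<not> ?thesis"
    then have eq: "integral\<^sup>L \<gamma> (tent a k) = integral\<^sup>L \<eta> (tent a k)" for a k
      using tent_in_bounded_support_continuous by blast
    have "measure \<gamma> {a} = measure \<eta> {a}" for a
      using integral_tent_tendsto[of \<gamma> a] integral_tent_tendsto[of \<eta> a] * eq
      by (auto intro: LIMSEQ_unique)
    moreover have "emeasure \<gamma> {a} < \<infinity>" "emeasure \<eta> {a} < \<infinity>" for a
      using * emeasure_bounded_finite[of _ "{a}"] closed_in_sets[of "{a}"] by simp_all
    ultimately have "emeasure \<gamma> {a} = emeasure \<eta> {a}" for a
      by (simp add: emeasure_eq_ennreal_measure less_top)
    then show False using * configurations_eqI by blast
  qed
  then obtain f where f: "f \<in> bounded_support_continuous" "integral\<^sup>L \<gamma> f \<noteq> integral\<^sup>L \<eta> f" by blast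
  then obtain U V where UV: "open U" "open V" "integral\<^sup>L \<gamma> f \<in> U" "integral\<^sup>L \<eta> f \<in> V" "U \<inter> V = {}"
    using hausdorff[OF f(2)] by blast
  have "openin (vague_topology m) {\<gamma> \<in> configurations m. integral\<^sup>L \<gamma> f \<in> W}" if "open W" for W
    unfolding vague_topology_def using f(1) that by (intro topology_generated_by_Basis) blast
  then show "\<exists>U V. openin (vague_topology m) U \<and> openin (vague_topology m) V \<and>
      \<gamma> \<in> U \<and> \<eta> \<in> V \<and> disjnt U V"
    using UV * by (intro exI[of _ "{\<gamma> \<in> configurations m. integral\<^sup>L \<gamma> f \<in> U}"]
        exI[of _ "{\<gamma> \<in> configurations m. integral\<^sup>L \<gamma> f \<in> V}"]) (auto simp: disjnt_def)
qed

section \<open>Couplings of configurations as matrices\<close>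

lemma ennreal_eq_one_if_mult_eq_self:
  fixes e h :: ennreal
  assumes "e = h * e" "0 < e" "e < \<infinity>"
  shows "h = 1"
proof -
  have "h = h * e / e" using assms(2,3) by (simp add: ennreal_mult_divide_eq)
  also have "\<dots> = 1" using assms by (simp add: ennreal_divide_self)
  finally show ?thesis .
qed

lemma sigma_finite_configuration:
  assumes "\<gamma> \<in> configurations m"
  shows "sigma_finite_measure \<gamma>"
proof
  define A where "A n = cball (undefined :: 'a) (real n)" for n
  have "A n \<in> sets m" "emeasure \<gamma> (A n) < \<infinity>" for n
    using emeasure_bounded_finite[OF assms, of "A n"] by (auto simp: A_def)
  moreover have "(\<Union>n. A n) = UNIV"
    by (auto simp: A_def real_arch_simple)
  moreover have "sets \<gamma> = sets m" by (rule sets_configurations[OF assms])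
  moreover from this have "space \<gamma> = UNIV"
    using sets_eq_imp_space_eq space_UNIV by metis
  ultimately show "\<exists>A. countable A \<and> A \<subseteq> sets \<gamma> \<and> \<Union> A = space \<gamma> \<and> (\<forall>a\<in>A. emeasure \<gamma> a \<noteq> \<infinity>)"
    by (intro exI[of _ "range A"]) (auto simp: less_top)
qed

lemma sets_pair_configuration_of:
  "sets (configuration_of m N x \<Otimes>\<^sub>M configuration_of m M y) = sets (m \<Otimes>\<^sub>M m)"
  by (intro sets_pair_measure_cong) simp_all

lemma measurable_dist_square: "(\<lambda>(a, b). ennreal ((dist a b)\<^sup>2)) \<in> borel_measurable (m \<Otimes>\<^sub>M m)"
proof -
  have "(\<lambda>z. dist (fst z) (snd z)) \<in> borel_measurable (m \<Otimes>\<^sub>M m)"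
    by (intro borel_measurable_dist measurable_compose[OF measurable_fst measurable_borel]
        measurable_compose[OF measurable_snd measurable_borel]) simp_all
  then show ?thesis by (simp add: split_beta)
qed

lemma emeasure_singleton_configuration_of:
  assumes "configuration_of m N x \<in> configurations m" "i \<in> indices N"
  shows "0 < emeasure (configuration_of m N x) {x i}" "emeasure (configuration_of m N x) {x i} < \<infinity>"
proof -
  have "x -` {x i} \<inter> indices N \<noteq> {}" using assms(2) by auto
  then show "0 < emeasure (configuration_of m N x) {x i}"
    by (simp add: emeasure_configuration_of closed_in_sets emeasure_count_space card_gt_0_iff
        zero_less_iff_neq_zero)
  show "emeasure (configuration_of m N x) {x i} < \<infinity>"
    by (rule emeasure_bounded_finite[OF assms(1)]) auto
qed

text \<open>A null set of the product of the marginals contains no pair of atoms, whereas a coupling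
  gives no mass to the complement of the set of pairs of atoms.\<close>

lemma coupling_absolutely_continuous:
  assumes \<gamma>: "configuration_of m N x \<in> configurations m" (is "?\<gamma> \<in> _")
    and \<eta>: "configuration_of m M y \<in> configurations m" (is "?\<eta> \<in> _")
    and q: "q \<in> couplings m (configuration_of m N x) (configuration_of m M y)"
  shows "absolutely_continuous (configuration_of m N x \<Otimes>\<^sub>M configuration_of m M y) q"
  unfolding absolutely_continuous_def
proof
  interpret \<gamma>: sigma_finite_measure ?\<gamma> by (rule sigma_finite_configuration[OF \<gamma>])
  interpret \<eta>: sigma_finite_measure ?\<eta> by (rule sigma_finite_configuration[OF \<eta>])
  have sets: "sets q = sets (m \<Otimes>\<^sub>M m)" and marg: "distr q m fst = ?\<gamma>" "distr q m snd = ?\<eta>"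
    using q by (auto simp: couplings_def)
  have space: "space q = UNIV"
    using sets_eq_imp_space_eq[OF sets] by (simp add: space_pair_measure space_UNIV)
  have meas: "fst \<in> measurable q m" "snd \<in> measurable q m"
    by (simp_all add: measurable_cong_sets[OF sets refl])
  fix Z assume Z: "Z \<in> null_sets (?\<gamma> \<Otimes>\<^sub>M ?\<eta>)"
  have ZM: "Z \<in> sets (m \<Otimes>\<^sub>M m)"
    using Z sets_pair_configuration_of by auto
  define X Y where "X = x ` indices N" and "Y = y ` indices M"
  have XY: "X \<in> sets m" "Y \<in> sets m"
    unfolding X_def Y_def by (rule countable_in_sets; simp)+
  have "(x i, y j) \<notin> Z" if ij: "i \<in> indices N" "j \<in> indices M" for i j
  proof
    assume "(x i, y j) \<in> Z"
    then have "{x i} \<times> {y j} \<subseteq> Z" by simp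
    then have "emeasure (?\<gamma> \<Otimes>\<^sub>M ?\<eta>) ({x i} \<times> {y j}) \<le> emeasure (?\<gamma> \<Otimes>\<^sub>M ?\<eta>) Z"
      using Z by (intro emeasure_mono) auto
    moreover have "emeasure (?\<gamma> \<Otimes>\<^sub>M ?\<eta>) ({x i} \<times> {y j}) = emeasure ?\<gamma> {x i} * emeasure ?\<eta> {y j}"
      by (rule \<eta>.emeasure_pair_measure_Times) (simp_all add: closed_in_sets)
    ultimately have "emeasure ?\<gamma> {x i} * emeasure ?\<eta> {y j} = 0"
      using Z by (simp add: null_setsD1)
    then show False
      using emeasure_singleton_configuration_of(1)[OF \<gamma> ij(1)]
        emeasure_singleton_configuration_of(1)[OF \<eta> ij(2)] by auto
  qed
  then have sub: "Z \<subseteq> fst -` (UNIV - X) \<union> snd -` (UNIV - Y)"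
    by (auto simp: X_def Y_def)
  have "emeasure q (fst -` (UNIV - X)) = emeasure (distr q m fst) (UNIV - X)"
    using XY meas space by (subst emeasure_distr) (auto simp: space_UNIV[symmetric])
  also have "\<dots> = 0"
  proof -
    have "x -` (UNIV - X) \<inter> indices N = {}" by (auto simp: X_def)
    then show ?thesis
      using sets.compl_sets[OF XY(1)]
      by (simp add: marg emeasure_configuration_of space_UNIV)
  qed
  finally have q0: "emeasure q (fst -` (UNIV - X)) = 0" .
  have "emeasure q (snd -` (UNIV - Y)) = emeasure (distr q m snd) (UNIV - Y)"
    using XY meas space by (subst emeasure_distr) (auto simp: space_UNIV[symmetric])
  also have "\<dots> = 0"
  proof -
    have "y -` (UNIV - Y) \<inter> indices M = {}" by (auto simp: Y_def)
    then show ?thesis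
      using sets.compl_sets[OF XY(2)]
      by (simp add: marg emeasure_configuration_of space_UNIV)
  qed
  finally have q1: "emeasure q (snd -` (UNIV - Y)) = 0" .
  have in_q: "fst -` (UNIV - X) \<in> sets q" "snd -` (UNIV - Y) \<in> sets q"
    using measurable_sets[OF meas(1), of "UNIV - X"] measurable_sets[OF meas(2), of "UNIV - Y"]
      sets.compl_sets[OF XY(1)] sets.compl_sets[OF XY(2)] space by (simp_all add: space_UNIV)
  then have "fst -` (UNIV - X) \<union> snd -` (UNIV - Y) \<in> null_sets q"
    using q0 q1 by (intro null_sets.Un) auto
  then show "Z \<in> null_sets q"
    using null_sets_subset[OF _ _ sub] ZM sets by blast
qed

text \<open>The entries \<open>w i j\<close> with \<open>i\<close> below \<open>N\<close> and \<open>j\<close> below \<open>M\<close> have row and column sums one,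
  where negative entries count as zero.\<close>

definition unit_sum_matrix :: "enat \<Rightarrow> enat \<Rightarrow> (nat \<Rightarrow> nat \<Rightarrow> real) \<Rightarrow> bool" where
  "unit_sum_matrix N M w \<longleftrightarrow>
    (\<forall>i\<in>indices N. (\<integral>\<^sup>+j. ennreal (w i j) \<partial>count_space (indices M)) = 1) \<and>
    (\<forall>j\<in>indices M. (\<integral>\<^sup>+i. ennreal (w i j) \<partial>count_space (indices N)) = 1)"

text \<open>The transport cost when mass \<open>w i j\<close> moves from \<open>x i\<close> to \<open>y j\<close>.\<close>

definition matrix_cost ::
    "enat \<Rightarrow> enat \<Rightarrow> (nat \<Rightarrow> 'a) \<Rightarrow> (nat \<Rightarrow> 'a) \<Rightarrow> (nat \<Rightarrow> nat \<Rightarrow> real) \<Rightarrow> ennreal" where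
  "matrix_cost N M x y w = (\<integral>\<^sup>+i. \<integral>\<^sup>+j. ennreal (w i j) * ennreal ((dist (x i) (y j))\<^sup>2)
     \<partial>count_space (indices M) \<partial>count_space (indices N))"

text \<open>The entry at \<open>(i, j)\<close> is the density at \<open>(x i, y j)\<close> of the coupling with respect to the
  product of its marginals.  Multiplicities need no separate treatment: the mass of the
  coupling at a repeated pair is shared equally among the index pairs that give it.\<close>

lemma matrix_of_coupling:
  assumes \<gamma>: "configuration_of m N x \<in> configurations m" (is "?\<gamma> \<in> _")
    and \<eta>: "configuration_of m M y \<in> configurations m" (is "?\<eta> \<in> _")
    and q: "q \<in> couplings m (configuration_of m N x) (configuration_of m M y)"
  obtains w where "unit_sum_matrix N M w"
    "matrix_cost N M x y w = (\<integral>\<^sup>+(a, b). ennreal ((dist a b)\<^sup>2) \<partial>q)"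
proof -
  interpret \<gamma>: sigma_finite_measure ?\<gamma> by (rule sigma_finite_configuration[OF \<gamma>])
  interpret \<eta>: sigma_finite_measure ?\<eta> by (rule sigma_finite_configuration[OF \<eta>])
  interpret pair_sigma_finite ?\<gamma> ?\<eta> ..
  have sets: "sets q = sets (m \<Otimes>\<^sub>M m)" and marg: "distr q m fst = ?\<gamma>" "distr q m snd = ?\<eta>"
    using q by (auto simp: couplings_def)
  have "\<exists>h\<in>borel_measurable (?\<gamma> \<Otimes>\<^sub>M ?\<eta>). density (?\<gamma> \<Otimes>\<^sub>M ?\<eta>) h = q"
    using coupling_absolutely_continuous[OF assms]
    by (intro Radon_Nikodym) (simp_all add: sets sets_pair_configuration_of)
  then obtain h where h [measurable]: "h \<in> borel_measurable (?\<gamma> \<Otimes>\<^sub>M ?\<eta>)"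
    and hq: "density (?\<gamma> \<Otimes>\<^sub>M ?\<eta>) h = q" by blast
  have meas_pair: "borel_measurable (?\<gamma> \<Otimes>\<^sub>M ?\<eta>) = borel_measurable (m \<Otimes>\<^sub>M m)"
    by (intro measurable_cong_sets sets_pair_configuration_of refl)
  have meas_q: "measurable q m = measurable (m \<Otimes>\<^sub>M m) m"
    by (intro measurable_cong_sets sets refl)
  have meas_\<gamma>: "borel_measurable ?\<gamma> = borel_measurable m" "borel_measurable ?\<eta> = borel_measurable m"
    by (intro measurable_cong_sets; simp)+
  have int_q: "(\<integral>\<^sup>+z. g z \<partial>q) = (\<integral>\<^sup>+z. h z * g z \<partial>(?\<gamma> \<Otimes>\<^sub>M ?\<eta>))"
    if "g \<in> borel_measurable (m \<Otimes>\<^sub>M m)" for g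
    using that h unfolding hq[symmetric] by (intro nn_integral_density) (auto simp: meas_pair)
  have row: "(\<integral>\<^sup>+b. h (x i, b) \<partial>?\<eta>) = 1" if i: "i \<in> indices N" for i
  proof -
    have ind: "(\<lambda>z. indicator {x i} (fst z) :: ennreal) \<in> borel_measurable (m \<Otimes>\<^sub>M m)"
      by (intro measurable_compose[OF measurable_fst] borel_measurable_indicator closed_in_sets) simp
    then have ind': "(\<lambda>z. h z * indicator {x i} (fst z)) \<in> borel_measurable (?\<gamma> \<Otimes>\<^sub>M ?\<eta>)"
      using h by (simp add: meas_pair)
    have "emeasure ?\<gamma> {x i} = (\<integral>\<^sup>+a. indicator {x i} a \<partial>distr q m fst)"
      by (simp add: marg closed_in_sets)
    also have "\<dots> = (\<integral>\<^sup>+z. indicator {x i} (fst z) \<partial>q)"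
      by (rule nn_integral_distr) (auto simp: meas_q intro!: borel_measurable_indicator closed_in_sets)
    also have "\<dots> = (\<integral>\<^sup>+z. h z * indicator {x i} (fst z) \<partial>(?\<gamma> \<Otimes>\<^sub>M ?\<eta>))"
      by (rule int_q[OF ind])
    also have "\<dots> = (\<integral>\<^sup>+a. \<integral>\<^sup>+b. h (a, b) * indicator {x i} a \<partial>?\<eta> \<partial>?\<gamma>)"
      using \<eta>.nn_integral_fst[OF ind'] by simp
    also have "\<dots> = (\<integral>\<^sup>+a. (\<integral>\<^sup>+b. h (x i, b) \<partial>?\<eta>) * indicator {x i} a \<partial>?\<gamma>)"
      by (intro nn_integral_cong) (auto simp: indicator_def)
    also have "\<dots> = (\<integral>\<^sup>+b. h (x i, b) \<partial>?\<eta>) * emeasure ?\<gamma> {x i}"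
      by (rule nn_integral_cmult_indicator) (simp add: closed_in_sets)
    finally show ?thesis
      using emeasure_singleton_configuration_of[OF \<gamma> i] by (rule ennreal_eq_one_if_mult_eq_self)
  qed
  have column: "(\<integral>\<^sup>+a. h (a, y j) \<partial>?\<gamma>) = 1" if j: "j \<in> indices M" for j
  proof -
    have ind: "(\<lambda>z. indicator {y j} (snd z) :: ennreal) \<in> borel_measurable (m \<Otimes>\<^sub>M m)"
      by (intro measurable_compose[OF measurable_snd] borel_measurable_indicator closed_in_sets) simp
    then have ind': "(\<lambda>z. h z * indicator {y j} (snd z)) \<in> borel_measurable (?\<gamma> \<Otimes>\<^sub>M ?\<eta>)"
      using h by (simp add: meas_pair)
    have "emeasure ?\<eta> {y j} = (\<integral>\<^sup>+b. indicator {y j} b \<partial>distr q m snd)"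
      by (simp add: marg closed_in_sets)
    also have "\<dots> = (\<integral>\<^sup>+z. indicator {y j} (snd z) \<partial>q)"
      by (rule nn_integral_distr) (auto simp: meas_q intro!: borel_measurable_indicator closed_in_sets)
    also have "\<dots> = (\<integral>\<^sup>+z. h z * indicator {y j} (snd z) \<partial>(?\<gamma> \<Otimes>\<^sub>M ?\<eta>))"
      by (rule int_q[OF ind])
    also have "\<dots> = (\<integral>\<^sup>+b. \<integral>\<^sup>+a. h (a, b) * indicator {y j} b \<partial>?\<gamma> \<partial>?\<eta>)"
      using nn_integral_snd[of "\<lambda>z. h z * indicator {y j} (snd z)"] ind' by simp
    also have "\<dots> = (\<integral>\<^sup>+b. (\<integral>\<^sup>+a. h (a, y j) \<partial>?\<gamma>) * indicator {y j} b \<partial>?\<eta>)"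
      by (intro nn_integral_cong) (auto simp: indicator_def)
    also have "\<dots> = (\<integral>\<^sup>+a. h (a, y j) \<partial>?\<gamma>) * emeasure ?\<eta> {y j}"
      by (rule nn_integral_cmult_indicator) (simp add: closed_in_sets)
    finally show ?thesis
      using emeasure_singleton_configuration_of[OF \<eta> j] by (rule ennreal_eq_one_if_mult_eq_self)
  qed
  have h_pair: "(\<lambda>b. h (a, b)) \<in> borel_measurable m" "(\<lambda>a. h (a, b)) \<in> borel_measurable m" for a b
    using h measurable_Pair2[of h m m borel a] measurable_Pair1[of h m m borel b]
    by (auto simp: meas_pair space_UNIV)
  \<comment> \<open>By the row sums the density is at most one at pairs of atoms, so it is real there.\<close>
  define w where "w i j = enn2real (h (x i, y j))" for i j
  have hw: "h (x i, y j) = ennreal (w i j)" if "i \<in> indices N" "j \<in> indices M" for i j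
  proof -
    have "h (x i, y j) \<le> (\<integral>\<^sup>+j. h (x i, y j) \<partial>count_space (indices M))"
      using that(2) by (rule nn_integral_ge_point)
    also have "\<dots> = 1"
      using row[OF that(1)] h_pair(1) by (simp add: nn_integral_configuration_of)
    finally have "h (x i, y j) < top" using le_less_trans by fastforce
    then show ?thesis by (simp add: w_def)
  qed
  have "unit_sum_matrix N M w"
    unfolding unit_sum_matrix_def
  proof (intro conjI ballI)
    fix i assume i: "i \<in> indices N"
    have "(\<integral>\<^sup>+j. ennreal (w i j) \<partial>count_space (indices M)) =
        (\<integral>\<^sup>+j. h (x i, y j) \<partial>count_space (indices M))"
      by (intro nn_integral_cong) (simp add: hw[OF i])
    then show "(\<integral>\<^sup>+j. ennreal (w i j) \<partial>count_space (indices M)) = 1"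
      using row[OF i] h_pair(1) by (simp add: nn_integral_configuration_of)
  next
    fix j assume j: "j \<in> indices M"
    have "(\<integral>\<^sup>+i. ennreal (w i j) \<partial>count_space (indices N)) =
        (\<integral>\<^sup>+i. h (x i, y j) \<partial>count_space (indices N))"
      by (intro nn_integral_cong) (simp add: hw[OF _ j])
    then show "(\<integral>\<^sup>+i. ennreal (w i j) \<partial>count_space (indices N)) = 1"
      using column[OF j] h_pair(2) by (simp add: nn_integral_configuration_of)
  qed
  moreover have "matrix_cost N M x y w = (\<integral>\<^sup>+(a, b). ennreal ((dist a b)\<^sup>2) \<partial>q)"
  proof -
    define g where "g z = h z * (case z of (a, b) \<Rightarrow> ennreal ((dist a b)\<^sup>2))" for z
    have g: "g \<in> borel_measurable (m \<Otimes>\<^sub>M m)"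
      unfolding g_def
      by (intro borel_measurable_times_ennreal h[unfolded meas_pair] measurable_dist_square)
    then have g': "g \<in> borel_measurable (?\<gamma> \<Otimes>\<^sub>M ?\<eta>)" by (simp only: meas_pair)
    have "(\<integral>\<^sup>+(a, b). ennreal ((dist a b)\<^sup>2) \<partial>q) = (\<integral>\<^sup>+z. g z \<partial>(?\<gamma> \<Otimes>\<^sub>M ?\<eta>))"
      unfolding g_def by (rule int_q[OF measurable_dist_square])
    also have "\<dots> = (\<integral>\<^sup>+a. \<integral>\<^sup>+b. g (a, b) \<partial>?\<eta> \<partial>?\<gamma>)"
      using \<eta>.nn_integral_fst[OF g'] by simp
    also have "\<dots> = (\<integral>\<^sup>+i. \<integral>\<^sup>+b. g (x i, b) \<partial>?\<eta> \<partial>count_space (indices N))"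
      using \<eta>.borel_measurable_nn_integral_fst[OF g']
      by (intro nn_integral_configuration_of) (simp add: meas_\<gamma>)
    also have "\<dots> = (\<integral>\<^sup>+i. \<integral>\<^sup>+j. g (x i, y j) \<partial>count_space (indices M) \<partial>count_space (indices N))"
      using measurable_Pair2[OF g]
      by (intro nn_integral_cong nn_integral_configuration_of) (simp add: space_UNIV)
    also have "\<dots> = matrix_cost N M x y w"
      unfolding matrix_cost_def by (intro nn_integral_cong) (simp add: g_def hw)
    finally show ?thesis by simp
  qed
  ultimately show thesis by (rule that)
qed

lemma coupling_of_matrix:
  assumes "unit_sum_matrix N M w"
  obtains q where "q \<in> couplings m (configuration_of m N x) (configuration_of m M y)"
    "(\<integral>\<^sup>+(a, b). ennreal ((dist a b)\<^sup>2) \<partial>q) = matrix_cost N M x y w"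
proof -
  let ?I = "count_space (indices N)" and ?J = "count_space (indices M)"
  interpret I: sigma_finite_measure ?I by simp
  interpret J: sigma_finite_measure ?J by simp
  interpret IJ: pair_sigma_finite ?I ?J ..
  have eq: "?I \<Otimes>\<^sub>M ?J = count_space (indices N \<times> indices M)"
    by (rule pair_measure_countable) simp_all
  have meas: "f \<in> borel_measurable (?I \<Otimes>\<^sub>M ?J)" for f :: "nat \<times> nat \<Rightarrow> ennreal"
    by (simp add: eq)
  define W where "W = density (?I \<Otimes>\<^sub>M ?J) (\<lambda>(i, j). ennreal (w i j))"
  define xy where "xy = (\<lambda>(i, j). (x i, y j))"
  define q where "q = distr W (m \<Otimes>\<^sub>M m) xy"
  have xy: "xy \<in> measurable W (m \<Otimes>\<^sub>M m)"
    by (simp add: W_def eq space_pair_measure space_UNIV)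
  have int: "(\<integral>\<^sup>+z. g z \<partial>q) = (\<integral>\<^sup>+(i, j). ennreal (w i j) * g (x i, y j) \<partial>(?I \<Otimes>\<^sub>M ?J))"
    if g: "g \<in> borel_measurable (m \<Otimes>\<^sub>M m)" for g
  proof -
    have "(\<integral>\<^sup>+z. g z \<partial>q) = (\<integral>\<^sup>+ij. g (xy ij) \<partial>W)"
      unfolding q_def using xy g by (intro nn_integral_distr) auto
    also have "\<dots> = (\<integral>\<^sup>+ij. (case ij of (i, j) \<Rightarrow> ennreal (w i j)) * g (xy ij) \<partial>(?I \<Otimes>\<^sub>M ?J))"
      unfolding W_def by (intro nn_integral_density meas)
    finally show ?thesis by (simp add: xy_def case_prod_unfold)
  qed
  have fst_snd: "fst \<in> measurable q m" "snd \<in> measurable q m"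
    by (simp_all add: q_def)
  have "distr q m fst = configuration_of m N x"
  proof (rule measure_eqI)
    fix A assume "A \<in> sets (distr q m fst)"
    then have A: "A \<in> sets m" by simp
    have "emeasure (distr q m fst) A = (\<integral>\<^sup>+a. indicator A a \<partial>distr q m fst)"
      using A by simp
    also have "\<dots> = (\<integral>\<^sup>+z. indicator A (fst z) \<partial>q)"
      using A fst_snd by (intro nn_integral_distr) auto
    also have "\<dots> = (\<integral>\<^sup>+(i, j). ennreal (w i j) * indicator A (x i) \<partial>(?I \<Otimes>\<^sub>M ?J))"
      using int[OF measurable_compose[OF measurable_fst borel_measurable_indicator[OF A]]] by simp
    also have "\<dots> = (\<integral>\<^sup>+i. \<integral>\<^sup>+j. ennreal (w i j) * indicator A (x i) \<partial>?J \<partial>?I)"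
      using J.nn_integral_fst[OF meas, of "\<lambda>(i, j). ennreal (w i j) * indicator A (x i)"] by simp
    also have "\<dots> = (\<integral>\<^sup>+i. indicator A (x i) \<partial>?I)"
      using assms by (intro nn_integral_cong)
        (simp add: nn_integral_multc unit_sum_matrix_def)
    also have "\<dots> = (\<integral>\<^sup>+a. indicator A a \<partial>configuration_of m N x)"
      using A by (intro nn_integral_configuration_of[symmetric]) simp
    also have "\<dots> = emeasure (configuration_of m N x) A" using A by simp
    finally show "emeasure (distr q m fst) A = emeasure (configuration_of m N x) A" .
  qed simp
  moreover have "distr q m snd = configuration_of m M y"
  proof (rule measure_eqI)
    fix A assume "A \<in> sets (distr q m snd)"
    then have A: "A \<in> sets m" by simp
    have "emeasure (distr q m snd) A = (\<integral>\<^sup>+a. indicator A a \<partial>distr q m snd)"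
      using A by simp
    also have "\<dots> = (\<integral>\<^sup>+z. indicator A (snd z) \<partial>q)"
      using A fst_snd by (intro nn_integral_distr) auto
    also have "\<dots> = (\<integral>\<^sup>+(i, j). ennreal (w i j) * indicator A (y j) \<partial>(?I \<Otimes>\<^sub>M ?J))"
      using int[OF measurable_compose[OF measurable_snd borel_measurable_indicator[OF A]]] by simp
    also have "\<dots> = (\<integral>\<^sup>+j. \<integral>\<^sup>+i. ennreal (w i j) * indicator A (y j) \<partial>?I \<partial>?J)"
      using IJ.nn_integral_snd[OF meas, of "\<lambda>(i, j). ennreal (w i j) * indicator A (y j)"] by simp
    also have "\<dots> = (\<integral>\<^sup>+j. indicator A (y j) \<partial>?J)"
      using assms by (intro nn_integral_cong)
        (simp add: nn_integral_multc unit_sum_matrix_def)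
    also have "\<dots> = (\<integral>\<^sup>+a. indicator A a \<partial>configuration_of m M y)"
      using A by (intro nn_integral_configuration_of[symmetric]) simp
    also have "\<dots> = emeasure (configuration_of m M y) A" using A by simp
    finally show "emeasure (distr q m snd) A = emeasure (configuration_of m M y) A" .
  qed simp
  ultimately have "q \<in> couplings m (configuration_of m N x) (configuration_of m M y)"
    by (simp add: couplings_def q_def)
  moreover have "(\<integral>\<^sup>+(a, b). ennreal ((dist a b)\<^sup>2) \<partial>q) = matrix_cost N M x y w"
    unfolding int[OF measurable_dist_square] matrix_cost_def
    using J.nn_integral_fst[OF meas, of "\<lambda>(i, j). ennreal (w i j) * ennreal ((dist (x i) (y j))\<^sup>2)"]
    by simp
  ultimately show thesis by (rule that)
qed

lemma d_conf_less_iff: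
  assumes "configuration_of m N x \<in> configurations m" "configuration_of m M y \<in> configurations m"
  shows "d_conf m (configuration_of m N x) (configuration_of m M y) < r \<longleftrightarrow>
    (\<exists>w. unit_sum_matrix N M w \<and> ennreal_sqrt (matrix_cost N M x y w) < r)"
  unfolding d_conf_def INF_less_iff
  by (metis matrix_of_coupling[OF assms] coupling_of_matrix)

section \<open>Measurability of the distance to a Borel set\<close>

lemma nn_integral_indices:
  "(\<integral>\<^sup>+i. f i \<partial>count_space (indices N)) = (\<Sum>i. f i * indicator (indices N) i)"
  by (simp add: nn_integral_count_space_indicator nn_integral_count_space_nat)

lemma ennreal_sqrt_measurable: "ennreal_sqrt \<in> borel_measurable borel"
  unfolding ennreal_sqrt_def by measurable

lemma borel_configuration_of_vimage:
  assumes "\<Xi> \<in> sets (borel_algebra (vague_topology m))"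
  shows "{z \<in> marked_sequences p N. configuration_of m N (fst z) \<in> \<Xi>} \<in> sets borel"
proof -
  let ?P = "marked_sequences p N"
  let ?\<psi> = "\<lambda>(x, c :: nat \<Rightarrow> real). configuration_of m N x"
  let ?T = "vague_topology m"
  have P: "?P \<in> sets borel" by (rule borel_closed[OF closed_marked_sequences])
  have cont: "continuous_map (top_of_set ?P) ?T ?\<psi>"
    by (rule continuous_map_configuration_of)
  have "?\<psi> \<in> measurable (restrict_space borel ?P) (borel_algebra ?T)"
    unfolding borel_algebra_def
  proof (rule measurable_measure_of)
    show "{U. openin ?T U} \<subseteq> Pow (topspace ?T)" using openin_subset by auto
    show "?\<psi> \<in> space (restrict_space borel ?P) \<rightarrow> topspace ?T"
      using cont by (auto simp: continuous_map_def space_restrict_space)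
    fix U assume "U \<in> {U. openin ?T U}"
    then have "openin (top_of_set ?P) {z \<in> ?P. ?\<psi> z \<in> U}"
      using openin_continuous_map_preimage[OF cont] by simp
    then obtain V where "open V" "{z \<in> ?P. ?\<psi> z \<in> U} = ?P \<inter> V"
      by (auto simp: openin_open)
    moreover have "?\<psi> -` U \<inter> space (restrict_space borel ?P) = {z \<in> ?P. ?\<psi> z \<in> U}"
      by (auto simp: space_restrict_space)
    ultimately show "?\<psi> -` U \<inter> space (restrict_space borel ?P) \<in> sets (restrict_space borel ?P)"
      by (simp add: sets_restrict_space)
  qed
  from measurable_sets[OF this assms]
  have "?\<psi> -` \<Xi> \<inter> ?P \<in> sets borel"
    using P by (simp add: sets_restrict_space_iff space_restrict_space)
  moreover have "?\<psi> -` \<Xi> \<inter> ?P = {z \<in> ?P. configuration_of m N (fst z) \<in> \<Xi>}"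
    by auto
  ultimately show ?thesis by simp
qed

text \<open>The configurations with \<open>N\<close> points at distance less than \<open>r\<close> from some configuration
  in \<open>\<Xi>\<close> with \<open>M\<close> points are the continuous image of a Borel set, which consists of codes of
  the two configurations together with a matrix of sufficiently small cost.\<close>

lemma analytic_in_sublevel:
  fixes p :: 'a
  assumes \<Xi>: "\<Xi> \<in> sets (borel_algebra (vague_topology m))"
  defines "P \<equiv> marked_sequences p"
  shows "analytic_in (vague_topology m) {configuration_of m N x | x c y d.
    (x, c) \<in> P N \<and> (y, d) \<in> P M \<and> configuration_of m M y \<in> \<Xi> \<and>
    d_conf m (configuration_of m N x) (configuration_of m M y) < r}"
    (is "analytic_in _ ?A")
proof -
  define Q where "Q = {z \<in> P M. configuration_of m M (fst z) \<in> \<Xi>}"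
  define G where "G = {z :: 'a code \<times> 'a code \<times> (nat \<Rightarrow> nat \<Rightarrow> real).
      fst z \<in> P N \<and> fst (snd z) \<in> Q \<and> unit_sum_matrix N M (snd (snd z)) \<and>
      ennreal_sqrt (matrix_cost N M (fst (fst z)) (fst (fst (snd z))) (snd (snd z))) < r}"
  have PB: "P N \<in> sets borel"
    unfolding P_def by (rule borel_closed[OF closed_marked_sequences])
  have QB: "Q \<in> sets borel"
    unfolding Q_def P_def by (rule borel_configuration_of_vimage[OF \<Xi>])
  have w: "(\<lambda>z :: 'a code \<times> 'a code \<times> (nat \<Rightarrow> nat \<Rightarrow> real).
      snd (snd z) i j) \<in> borel_measurable borel" for i j
    by (rule borel_measurable_continuous_onI,
        rule continuous_on_product_then_coordinatewise[OF continuous_on_product_then_coordinatewise])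
      (intro continuous_on_snd continuous_on_id)
  have x: "(\<lambda>z :: 'a code \<times> 'a code \<times> (nat \<Rightarrow> nat \<Rightarrow> real).
      dist (fst (fst z) i) (fst (fst (snd z)) j)) \<in> borel_measurable borel" for i j
    by (rule borel_measurable_continuous_onI, rule continuous_on_dist;
        rule continuous_on_product_then_coordinatewise)
      (intro continuous_on_fst continuous_on_snd continuous_on_id)+
  have row: "(\<lambda>z :: 'a code \<times> 'a code \<times> (nat \<Rightarrow> nat \<Rightarrow> real).
      \<integral>\<^sup>+j. ennreal (snd (snd z) i j) \<partial>count_space (indices M)) \<in> borel_measurable borel" for i
    unfolding nn_integral_indices
    by (intro borel_measurable_suminf_order borel_measurable_times_ennreal borel_measurable_const
        measurable_compose[OF w measurable_ennreal])
  have column: "(\<lambda>z :: 'a code \<times> 'a code \<times> (nat \<Rightarrow> nat \<Rightarrow> real).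
      \<integral>\<^sup>+i. ennreal (snd (snd z) i j) \<partial>count_space (indices N)) \<in> borel_measurable borel" for j
    unfolding nn_integral_indices
    by (intro borel_measurable_suminf_order borel_measurable_times_ennreal borel_measurable_const
        measurable_compose[OF w measurable_ennreal])
  have cost: "(\<lambda>z :: 'a code \<times> 'a code \<times> (nat \<Rightarrow> nat \<Rightarrow> real).
      ennreal_sqrt (matrix_cost N M (fst (fst z)) (fst (fst (snd z))) (snd (snd z))))
      \<in> borel_measurable borel"
    unfolding matrix_cost_def nn_integral_indices
    by (intro measurable_compose[OF _ ennreal_sqrt_measurable] borel_measurable_suminf_order
        borel_measurable_times_ennreal borel_measurable_const measurable_compose[OF w measurable_ennreal]
        measurable_compose[OF _ measurable_ennreal] borel_measurable_power x)
  let ?B = "borel :: ('a code \<times> 'a code \<times> (nat \<Rightarrow> nat \<Rightarrow> real)) measure"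
  have "fst -` P N \<inter> space ?B \<in> sets ?B" "(\<lambda>z. fst (snd z)) -` Q \<inter> space ?B \<in> sets ?B"
    by (intro measurable_sets[OF _ PB] measurable_sets[OF _ QB] borel_measurable_continuous_onI
        continuous_on_fst continuous_on_snd continuous_on_id)+
  moreover have "{z \<in> space ?B. unit_sum_matrix N M (snd (snd z))} \<in> sets ?B"
    unfolding unit_sum_matrix_def
    by (intro sets.sets_Collect_conj sets.sets_Collect_countable_Ball borel_measurable_eq row column
        borel_measurable_const countable_indices)
  moreover have "{z \<in> space ?B.
      ennreal_sqrt (matrix_cost N M (fst (fst z)) (fst (fst (snd z))) (snd (snd z))) < r} \<in> sets ?B"
    by (intro borel_measurable_less cost borel_measurable_const)
  ultimately have "(fst -` P N \<inter> space ?B) \<inter> ((\<lambda>z. fst (snd z)) -` Q \<inter> space ?B) \<inter>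
      {z \<in> space ?B. unit_sum_matrix N M (snd (snd z))} \<inter> {z \<in> space ?B.
      ennreal_sqrt (matrix_cost N M (fst (fst z)) (fst (fst (snd z))) (snd (snd z))) < r} \<in> sets ?B"
    by (meson sets.Int)
  also have "(fst -` P N \<inter> space ?B) \<inter> ((\<lambda>z. fst (snd z)) -` Q \<inter> space ?B) \<inter>
      {z \<in> space ?B. unit_sum_matrix N M (snd (snd z))} \<inter> {z \<in> space ?B.
      ennreal_sqrt (matrix_cost N M (fst (fst z)) (fst (fst (snd z))) (snd (snd z))) < r} = G"
    unfolding G_def space_borel by blast
  finally have "G \<in> sets ?B" .
  then have "analytic_in euclidean G" by (rule analytic_in_borel)
  moreover have "continuous_map (top_of_set G) (vague_topology m) (\<lambda>z. configuration_of m N (fst (fst z)))"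
  proof -
    have "continuous_map (top_of_set G) (top_of_set (P N)) fst"
      by (auto simp: G_def intro: continuous_intros)
    from continuous_map_compose[OF this continuous_map_configuration_of[of p N, folded P_def]]
    show ?thesis by (simp add: o_def split_beta)
  qed
  ultimately have "analytic_in (vague_topology m) ((\<lambda>z. configuration_of m N (fst (fst z))) ` G)"
    by (rule analytic_in_image)
  moreover have "(\<lambda>z. configuration_of m N (fst (fst z))) ` G = ?A"
  proof -
    have "d_conf m (configuration_of m N x) (configuration_of m M y) < r \<longleftrightarrow>
        (\<exists>w. unit_sum_matrix N M w \<and> ennreal_sqrt (matrix_cost N M x y w) < r)"
      if "(x, c) \<in> P N" "(y, d) \<in> P M" for x c y d
      using that unfolding P_def by (intro d_conf_less_iff configuration_of_in_configurations)
    then show ?thesis unfolding G_def Q_def by (force simp: image_iff)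
  qed
  ultimately show ?thesis by simp
qed

lemma sublevel_eq_UN:
  fixes p :: 'a
  assumes \<Xi>: "\<Xi> \<subseteq> configurations m"
  defines "P \<equiv> marked_sequences p"
  shows "{\<gamma> \<in> configurations m. d_conf_set m \<gamma> \<Xi> < r} =
    (\<Union>N. \<Union>M. {configuration_of m N x | x c y d.
      (x, c) \<in> P N \<and> (y, d) \<in> P M \<and> configuration_of m M y \<in> \<Xi> \<and>
      d_conf m (configuration_of m N x) (configuration_of m M y) < r})" (is "?L = (\<Union>N. \<Union>M. ?A N M)")
proof (intro subset_antisym subsetI)
  fix \<gamma> assume "\<gamma> \<in> ?L"
  then obtain \<eta> where \<gamma>: "\<gamma> \<in> configurations m" and \<eta>: "\<eta> \<in> \<Xi>" "d_conf m \<gamma> \<eta> < r"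
    by (auto simp: d_conf_set_def INF_less_iff)
  obtain N x c where "\<gamma> = configuration_of m N x" "(x, c) \<in> P N"
    unfolding P_def using \<gamma> by (rule configurations_marked)
  moreover obtain M y d where "\<eta> = configuration_of m M y" "(y, d) \<in> P M"
    unfolding P_def using \<eta>(1) \<Xi> by (blast elim: configurations_marked)
  ultimately have "\<gamma> \<in> ?A N M" using \<eta> by blast
  then show "\<gamma> \<in> (\<Union>N. \<Union>M. ?A N M)" by blast
next
  fix \<gamma> assume "\<gamma> \<in> (\<Union>N. \<Union>M. ?A N M)"
  then obtain N M x c y d where "\<gamma> = configuration_of m N x" "(x, c) \<in> P N"
    "configuration_of m M y \<in> \<Xi>"
    "d_conf m (configuration_of m N x) (configuration_of m M y) < r" by blast
  then show "\<gamma> \<in> ?L"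
    using configuration_of_in_configurations unfolding P_def d_conf_set_def INF_less_iff by blast
qed

end

theorem corollary4p28:
  fixes m :: "'a::polish_space measure" and \<Xi> :: "'a measure set"
  assumes "metric_local_structure m"
    and "\<Xi> \<in> sets (borel_algebra (vague_topology m))"
  shows "(\<lambda>\<gamma>. d_conf_set m \<gamma> \<Xi>) \<in> borel_measurable (universal_algebra (vague_topology m))"
proof -
  interpret metric_local_structure m by fact
  let ?T = "vague_topology m"
  have \<Xi>: "\<Xi> \<subseteq> configurations m"
    using sets.sets_into_space[OF assms(2)] by (simp add: space_borel_algebra topspace_vague_topology)
  show ?thesis
  proof (rule borel_measurableI_less)
    fix r :: ennreal
    have "{\<gamma> \<in> configurations m. d_conf_set m \<gamma> \<Xi> < r} \<in> sets (universal_algebra ?T)"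
      \<comment> \<open>Any base point serves.\<close>
      unfolding sublevel_eq_UN[OF \<Xi>, of r undefined]
    proof (intro sets.countable_UN'')
      fix N M :: enat
      show "{configuration_of m N x | x c y d. (x, c) \<in> marked_sequences undefined N \<and>
          (y, d) \<in> marked_sequences undefined M \<and> configuration_of m M y \<in> \<Xi> \<and>
          d_conf m (configuration_of m N x) (configuration_of m M y) < r} \<in> sets (universal_algebra ?T)"
        using analytic_in_universally_measurable[OF Hausdorff_vague_topology
            analytic_in_sublevel[OF assms(2)]]
        by (simp add: sets_universal_algebra)
    qed auto
    then show "{\<gamma> \<in> space (universal_algebra ?T). d_conf_set m \<gamma> \<Xi> < r} \<in> sets (universal_algebra ?T)"
      by (simp add: space_universal_algebra topspace_vague_topology)
  qed
qed

end
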